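(* Let $n\in\{1,2,3\}$ and let $\Omega\subset\mathbb{R}^n$ be a bounded open connected set with Lipschitz boundary. Let $A(x,x')=\tilde A(|x-x'|)$ be a (symmetric) kernel with $A\in L^1(\Omega\times\Omega)$ which is strictly positive definite, and let the constant stiffness tensor $C$ satisfy, for some constants $\overline C\ge\underline C>0$, $\underline C\,\epsilon:\epsilon\le C\epsilon:\epsilon\le\overline C\,\epsilon:\epsilon$ for all symmetric matrices $\epsilon\in\mathbb{S}^n$. Then the bilinear form $a(\cdot,\cdot)$ is bounded and coercive on $V_A$; precisely, for all $u,v\in V_A$, $$|a(u,v)|\le\overline C\,\|u\|_A\,\|v\|_A\qquad\text{and}\qquad a(u,u)\ge\tfrac12\,\underline C\,(u,u)_A .$$
   Context: $\tilde A:\mathbb{R}\to\mathbb{R}$ is an even function (defined on $[0,\infty)$ and extended evenly). $\mathbb{S}^n$ is the space of real symmetric $n\times n$ matrices and $\alpha:\beta=\sum_{k,m}\alpha_{km}\beta_{km}$ is the Frobenius product. The stiffness tensor $C$ is a constant fourth-order tensor with the usual symmetries $C_{ijkl}=C_{jikl}=C_{ijlk}=C_{klij}$, i.e. a self-adjoint linear map $\mathbb{S}^n\to\mathbb{S}^n$. The kernel $A$ is strictly positive definite if $\int_\Omega\int_\Omega A(x,x')\phi(x)\phi(x')\,dx'\,dx>0$ for all $\phi\in C_c^\infty(\Omega)\setminus\{0\}$ (real-valued $\phi$). For such $A$, $(u,v)_A=\int_\Omega\int_\Omega A(x,x')\,\nabla u(x):\nabla v(x')\,dx'\,dx$ is an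 inner product on $C_c^\infty(\Omega;\mathbb{R}^n)$ with induced norm $\|\cdot\|_A$, and $V_A$ is the Hilbert space completion of $C_c^\infty(\Omega;\mathbb{R}^n)$ with respect to it. For $u,v\in C_c^\infty(\Omega;\mathbb{R}^n)$, $a(u,v)=\int_\Omega\int_\Omega A(x,x')\,C\varepsilon_u(x):\varepsilon_v(x')\,dx'\,dx$, with $\varepsilon_u=\tfrac12[\nabla u+(\nabla u)^{\mathrm T}]$. On $V_A$ the form $a$ is understood as the extension by continuity from $C_c^\infty(\Omega;\mathbb{R}^n)$; the claim is thus that the inequalities hold on $C_c^\infty(\Omega;\mathbb{R}^n)$ and that $a$ consequently extends to $V_A$ with the same inequalities. *)

theory Defs
  imports "HOL-Analysis.Analysis"
begin

section \<open>Domains and test functions\<close>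

text \<open>
  Near every boundary point the set is the strict subgraph of a Lipschitz function, in suitably
  rotated coordinates: \<open>\<nu>\<close> is the unit vector of the graph direction and \<open>g\<close> is a function on the
  hyperplane orthogonal to \<open>\<nu>\<close>.  (In dimension one this hyperplane is \<open>{0}\<close> and \<open>g\<close> a constant.)
\<close>

definition lipschitz_boundary :: "'a::euclidean_space set \<Rightarrow> bool" where
  "lipschitz_boundary \<Omega> \<longleftrightarrow>
     (\<forall>p\<in>frontier \<Omega>. \<exists>r>0. \<exists>\<nu> g L. norm \<nu> = 1 \<and> L-lipschitz_on {y. y \<bullet> \<nu> = 0} g \<and>
        \<Omega> \<inter> ball p r = {x \<in> ball p r. x \<bullet> \<nu> < g (x - (x \<bullet> \<nu>) *\<^sub>R \<nu>)})"

primrec Ck :: "nat \<Rightarrow> ('a::euclidean_space \<Rightarrow> 'b::real_normed_vector) \<Rightarrow> bool" where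
  "Ck 0 f \<longleftrightarrow> continuous_on UNIV f"
| "Ck (Suc k) f \<longleftrightarrow>
     (\<forall>x. f differentiable (at x)) \<and> (\<forall>h. Ck k (\<lambda>x. frechet_derivative f (at x) h))"

definition smooth :: "('a::euclidean_space \<Rightarrow> 'b::real_normed_vector) \<Rightarrow> bool" where
  "smooth f \<longleftrightarrow> (\<forall>k. Ck k f)"

text \<open>
  An element of \<open>C_c^\<infinity>(\<Omega>)\<close> is identified with its extension by zero to the whole space.
\<close>

definition test_functions ::
    "'a::euclidean_space set \<Rightarrow> ('a \<Rightarrow> 'b::real_normed_vector) set" where
  "test_functions \<Omega> =
     {f. smooth f \<and> compact (closure {x. f x \<noteq> 0}) \<and> closure {x. f x \<noteq> 0} \<subseteq> \<Omega>}"


section \<open>Kernels and bilinear forms\<close>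

definition radial_kernel ::
    "(real \<Rightarrow> real) \<Rightarrow> 'a::real_normed_vector \<Rightarrow> 'a \<Rightarrow> real" where
  "radial_kernel At x x' = At (norm (x - x'))"

definition strictly_pos_def_kernel ::
    "'a::euclidean_space set \<Rightarrow> ('a \<Rightarrow> 'a \<Rightarrow> real) \<Rightarrow> bool" where
  "strictly_pos_def_kernel \<Omega> A \<longleftrightarrow>
     (\<forall>\<phi>\<in>test_functions \<Omega> - {\<lambda>x. 0}.
        0 < (LINT x:\<Omega>|lebesgue. LINT x':\<Omega>|lebesgue. A x x' * \<phi> x * \<phi> x'))"

definition grad :: "(real^'n \<Rightarrow> real^'n) \<Rightarrow> real^'n \<Rightarrow> real^'n^'n" where
  "grad u x = jacobian u (at x)"

definition strain :: "(real^'n \<Rightarrow> real^'n) \<Rightarrow> real^'n \<Rightarrow> real^'n^'n" where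
  "strain u x = (1 / 2) *\<^sub>R (grad u x + transpose (grad u x))"

definition symmetric_matrix :: "real^'n^'n \<Rightarrow> bool" where
  "symmetric_matrix M \<longleftrightarrow> transpose M = M"

definition stiffness_symmetries :: "real^'n^'n^'n^'n \<Rightarrow> bool" where
  "stiffness_symmetries C \<longleftrightarrow>
     (\<forall>i j k l. C$i$j$k$l = C$j$i$k$l \<and> C$i$j$k$l = C$i$j$l$k \<and> C$i$j$k$l = C$k$l$i$j)"

definition tensor_apply :: "real^'n^'n^'n^'n \<Rightarrow> real^'n^'n \<Rightarrow> real^'n^'n" where
  "tensor_apply C M = (\<chi> i j. \<Sum>k\<in>UNIV. \<Sum>l\<in>UNIV. C$i$j$k$l * M$k$l)"

text \<open>
  On matrices, the inner product \<open>\<bullet>\<close> of the type \<open>real^'n^'n\<close> is the Frobenius product.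
\<close>

definition inner_A ::
    "(real^'n) set \<Rightarrow> (real^'n \<Rightarrow> real^'n \<Rightarrow> real) \<Rightarrow>
     (real^'n \<Rightarrow> real^'n) \<Rightarrow> (real^'n \<Rightarrow> real^'n) \<Rightarrow> real" where
  "inner_A \<Omega> A u v =
     (LINT x:\<Omega>|lebesgue. LINT x':\<Omega>|lebesgue. A x x' * (grad u x \<bullet> grad v x'))"

definition form_a ::
    "(real^'n) set \<Rightarrow> (real^'n \<Rightarrow> real^'n \<Rightarrow> real) \<Rightarrow> real^'n^'n^'n^'n \<Rightarrow>
     (real^'n \<Rightarrow> real^'n) \<Rightarrow> (real^'n \<Rightarrow> real^'n) \<Rightarrow> real" where
  "form_a \<Omega> A C u v =
     (LINT x:\<Omega>|lebesgue. LINT x':\<Omega>|lebesgue.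
        A x x' * (tensor_apply C (strain u x) \<bullet> strain v x'))"


section \<open>Completion of a function space with an inner product\<close>

text \<open>
  \<open>S\<close> is a linear space of functions and \<open>p\<close> an inner product on \<open>S\<close>.  The completion consists
  of the classes of \<open>p\<close>-Cauchy sequences in \<open>S\<close> modulo sequences tending to \<open>0\<close>; it contains
  \<open>S\<close> through the classes of the constant sequences.
\<close>

definition form_norm :: "('v \<Rightarrow> 'v \<Rightarrow> real) \<Rightarrow> 'v \<Rightarrow> real" where
  "form_norm p u = sqrt (p u u)"

definition cauchy_seqs ::
    "('x \<Rightarrow> 'b::real_vector) set \<Rightarrow> (('x \<Rightarrow> 'b) \<Rightarrow> ('x \<Rightarrow> 'b) \<Rightarrow> real) \<Rightarrow>
     (nat \<Rightarrow> 'x \<Rightarrow> 'b) set" where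
  "cauchy_seqs S p =
     {u. (\<forall>k. u k \<in> S) \<and>
         (\<forall>e>0. \<exists>N. \<forall>j\<ge>N. \<forall>k\<ge>N. form_norm p (\<lambda>x. u j x - u k x) < e)}"

definition null_equiv ::
    "('x \<Rightarrow> 'b::real_vector) set \<Rightarrow> (('x \<Rightarrow> 'b) \<Rightarrow> ('x \<Rightarrow> 'b) \<Rightarrow> real) \<Rightarrow>
     ((nat \<Rightarrow> 'x \<Rightarrow> 'b) \<times> (nat \<Rightarrow> 'x \<Rightarrow> 'b)) set" where
  "null_equiv S p =
     {(u, v). u \<in> cauchy_seqs S p \<and> v \<in> cauchy_seqs S p \<and>
              (\<lambda>k. form_norm p (\<lambda>x. u k x - v k x)) \<longlonglongrightarrow> 0}"

definition hilbert_completion ::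
    "('x \<Rightarrow> 'b::real_vector) set \<Rightarrow> (('x \<Rightarrow> 'b) \<Rightarrow> ('x \<Rightarrow> 'b) \<Rightarrow> real) \<Rightarrow>
     (nat \<Rightarrow> 'x \<Rightarrow> 'b) set set" where
  "hilbert_completion S p = cauchy_seqs S p // null_equiv S p"

definition completion_add ::
    "('x \<Rightarrow> 'b::real_vector) set \<Rightarrow> (('x \<Rightarrow> 'b) \<Rightarrow> ('x \<Rightarrow> 'b) \<Rightarrow> real) \<Rightarrow>
     (nat \<Rightarrow> 'x \<Rightarrow> 'b) set \<Rightarrow> (nat \<Rightarrow> 'x \<Rightarrow> 'b) set \<Rightarrow> (nat \<Rightarrow> 'x \<Rightarrow> 'b) set" where
  "completion_add S p U W = (\<Union>u\<in>U. \<Union>w\<in>W. null_equiv S p `` {\<lambda>k x. u k x + w k x})"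

definition completion_scale ::
    "('x \<Rightarrow> 'b::real_vector) set \<Rightarrow> (('x \<Rightarrow> 'b) \<Rightarrow> ('x \<Rightarrow> 'b) \<Rightarrow> real) \<Rightarrow>
     real \<Rightarrow> (nat \<Rightarrow> 'x \<Rightarrow> 'b) set \<Rightarrow> (nat \<Rightarrow> 'x \<Rightarrow> 'b) set" where
  "completion_scale S p c U = (\<Union>u\<in>U. null_equiv S p `` {\<lambda>k x. c *\<^sub>R u k x})"

text \<open>
  The extension by continuity of a form \<open>F\<close> from \<open>S\<close> to the completion.  Its value is meaningful
  only if the limit exists and does not depend on the representatives, which is what
  \<open>extends_continuously\<close> expresses.
\<close>

definition form_ext ::
    "(('x \<Rightarrow> 'b) \<Rightarrow> ('x \<Rightarrow> 'b) \<Rightarrow> real) \<Rightarrow>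
     (nat \<Rightarrow> 'x \<Rightarrow> 'b) set \<Rightarrow> (nat \<Rightarrow> 'x \<Rightarrow> 'b) set \<Rightarrow> real" where
  "form_ext F U W = (THE l. \<forall>u\<in>U. \<forall>w\<in>W. (\<lambda>k. F (u k) (w k)) \<longlonglongrightarrow> l)"

definition extends_continuously ::
    "('x \<Rightarrow> 'b::real_vector) set \<Rightarrow> (('x \<Rightarrow> 'b) \<Rightarrow> ('x \<Rightarrow> 'b) \<Rightarrow> real) \<Rightarrow>
     (('x \<Rightarrow> 'b) \<Rightarrow> ('x \<Rightarrow> 'b) \<Rightarrow> real) \<Rightarrow> bool" where
  "extends_continuously S p F \<longleftrightarrow>
     (\<forall>U\<in>hilbert_completion S p. \<forall>W\<in>hilbert_completion S p. \<forall>u\<in>U. \<forall>w\<in>W.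
        (\<lambda>k. F (u k) (w k)) \<longlonglongrightarrow> form_ext F U W)"

definition bilinear_on_completion ::
    "('x \<Rightarrow> 'b::real_vector) set \<Rightarrow> (('x \<Rightarrow> 'b) \<Rightarrow> ('x \<Rightarrow> 'b) \<Rightarrow> real) \<Rightarrow>
     ((nat \<Rightarrow> 'x \<Rightarrow> 'b) set \<Rightarrow> (nat \<Rightarrow> 'x \<Rightarrow> 'b) set \<Rightarrow> real) \<Rightarrow> bool" where
  "bilinear_on_completion S p B \<longleftrightarrow>
     (\<forall>U\<in>hilbert_completion S p. \<forall>V\<in>hilbert_completion S p. \<forall>W\<in>hilbert_completion S p.
        B (completion_add S p U V) W = B U W + B V W \<and>
        B W (completion_add S p U V) = B W U + B W V) \<and>
     (\<forall>c. \<forall>U\<in>hilbert_completion S p. \<forall>W\<in>hilbert_completion S p.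
        B (completion_scale S p c U) W = c * B U W \<and>
        B W (completion_scale S p c U) = c * B W U)"

definition V_A ::
    "(real^'n) set \<Rightarrow> (real^'n \<Rightarrow> real^'n \<Rightarrow> real) \<Rightarrow>
     (nat \<Rightarrow> real^'n \<Rightarrow> real^'n) set set" where
  "V_A \<Omega> A = hilbert_completion (test_functions \<Omega>) (inner_A \<Omega> A)"

end

theory Submission
  imports Defs
begin

text \<open>
  Write \<open>T f g\<close> for the double integral of \<open>A(x,x') f(x) g(x')\<close> with scalar test functions \<open>f\<close> and \<open>g\<close>.
  It is a symmetric positive semidefinite bilinear form, and both the inner product of \<open>V_A\<close> and the
  elastic form are finite linear combinations of its values at partial derivatives of the components.
  Two facts then give the inequalities.

  The first is algebraic.  The elastic form at \<open>(u,u)\<close> is the entry sum of the entrywise product of the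
  matrix of \<open>C\<close> with the Gram matrix of the strain entries under \<open>T\<close>.  Applied to \<open>C - Clow I\<close> and \<open>Cup I - C\<close>,
  where \<open>I\<close> is the identity on symmetric matrices, the Schur product argument
  (\<open>Schur_product_sum_nonneg\<close>) shows that the elastic form lies between \<open>Clow\<close> and \<open>Cup\<close> times the
  form of \<open>I\<close>.  This argument replaces the pointwise comparison of integrands, which fails
  for a nonlocal form because the integrand at a pair of distinct points has no sign.

  The second is Korn's inequality for \<open>T\<close> (\<open>Korn\<close>): the form of \<open>I\<close> lies between one half and
  one times the squared norm.  As in the local case the factor one half comes from
  \<open>T (\<partial>\<^sub>i u\<^sub>j) (\<partial>\<^sub>j u\<^sub>i) = T (\<partial>\<^sub>j u\<^sub>j) (\<partial>\<^sub>i u\<^sub>i)\<close>, whose sum is \<open>T\<close> at the divergence.  This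
  identity is where the dependence of the kernel on \<open>x - x'\<close> enters
  (\<open>kernel_form_swap_derivatives\<close>).

  Boundedness for different arguments is the Cauchy-Schwarz inequality of the elastic form.  A bounded
  bilinear form extends to the completion, and the inequalities pass to the limit.
\<close>

section \<open>Lebesgue measure on products and measure-preserving maps\<close>

lemma AE_eq_sym:
  assumes "AE x in M. f x = g x"
  shows "AE x in M. g x = f x"
  using assms by eventually_elim simp

text \<open>
  The exceptional set lies in a Borel null set, whose preimage under \<open>\<tau>\<close> is again Borel and null.
\<close>

lemma AE_lebesgue_measure_preserving:
  fixes \<tau> :: "'a::euclidean_space \<Rightarrow> 'a"
  assumes \<tau>: "\<tau> \<in> borel \<rightarrow>\<^sub>M borel" and pres: "distr lborel borel \<tau> = lborel"
    and P: "AE x in lebesgue. P x"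
  shows "AE x in lebesgue. P (\<tau> x)"
proof -
  have "AE x in distr lborel borel \<tau>. P x"
    unfolding pres using P by (simp add: AE_completion_iff)
  then have "AE x in lborel. P (\<tau> x)"
    by (rule AE_distrD[rotated]) (use \<tau> in simp)
  then show ?thesis by (rule AE_completion)
qed

lemma integral_lebesgue_measure_preserving:
  fixes \<tau> :: "'a::euclidean_space \<Rightarrow> 'a" and f :: "'a \<Rightarrow> real"
  assumes \<tau>: "\<tau> \<in> borel \<rightarrow>\<^sub>M borel" and pres: "distr lborel borel \<tau> = lborel"
    and f: "f \<in> borel_measurable lebesgue"
  shows "(\<integral>x. f (\<tau> x) \<partial>lebesgue) = (\<integral>x. f x \<partial>lebesgue)"
proof -
  obtain g where g[measurable]: "g \<in> borel_measurable borel" and fg: "AE x in lborel. f x = g x"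
    using completion_ex_borel_measurable_real[OF f] by auto
  have fg': "AE x in lebesgue. f x = g x"
    using fg by (rule AE_completion)
  have g\<tau>: "(\<lambda>x. g (\<tau> x)) \<in> borel_measurable borel"
    using \<tau> g by (rule measurable_compose)
  have gl: "g \<in> borel_measurable lebesgue" "(\<lambda>x. g (\<tau> x)) \<in> borel_measurable lebesgue"
    using g g\<tau> by (auto intro!: measurable_completion)
  have eq: "AE x in lebesgue. f (\<tau> x) = g (\<tau> x)"
    by (rule AE_lebesgue_measure_preserving[OF \<tau> pres fg'])
  have f\<tau>: "(\<lambda>x. f (\<tau> x)) \<in> borel_measurable lebesgue"
    by (rule borel_measurable_AE[OF gl(2) AE_eq_sym[OF eq]])
  have "(\<integral>x. f (\<tau> x) \<partial>lebesgue) = (\<integral>x. g (\<tau> x) \<partial>lebesgue)"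
    by (rule integral_cong_AE[OF f\<tau> gl(2) eq])
  also have "\<dots> = (\<integral>x. g (\<tau> x) \<partial>lborel)"
    using g\<tau> by (intro integral_completion) simp
  also have "\<dots> = (\<integral>x. g x \<partial>distr lborel borel \<tau>)"
    using \<tau> by (intro integral_distr[symmetric]) simp_all
  also have "\<dots> = (\<integral>x. g x \<partial>lebesgue)"
    by (simp add: pres integral_completion)
  also have "\<dots> = (\<integral>x. f x \<partial>lebesgue)"
    by (rule integral_cong_AE[OF gl(1) f AE_eq_sym[OF fg']])
  finally show ?thesis .
qed

text \<open>
  Lebesgue measure on a product is the completion of the product measure and not the product of the
  completions, so the product-measure form of Fubini's theorem does not apply to \<open>F\<close> itself.
  It is applied to a Borel function equal to \<open>F\<close> almost everywhere; almost every section of the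
  exceptional set is null.
\<close>

lemma integral_lebesgue_iterated:
  fixes F :: "'a::euclidean_space \<times> 'b::euclidean_space \<Rightarrow> real"
  assumes F: "integrable lebesgue F"
  shows "(\<integral>x. (\<integral>y. F (x, y) \<partial>lebesgue) \<partial>lebesgue) = (\<integral>z. F z \<partial>lebesgue)"
proof -
  have Fm: "F \<in> borel_measurable lebesgue" using F by simp
  obtain g where g[measurable]: "g \<in> borel_measurable borel" and Fg: "AE z in lborel. F z = g z"
    using completion_ex_borel_measurable_real[OF Fm] by auto
  have Fg': "AE z in lebesgue. F z = g z"
    using Fg by (rule AE_completion)
  have gl: "g \<in> borel_measurable lebesgue"
    using g by (auto intro!: measurable_completion)
  have "integrable lebesgue g"
    using integrable_cong_AE[OF Fm gl Fg'] F by simp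
  then have gi: "integrable (lborel \<Otimes>\<^sub>M lborel) g"
    by (simp add: integrable_completion lborel_prod)
  have g2[measurable]: "g \<in> borel_measurable (lborel \<Otimes>\<^sub>M lborel)"
    using gi by simp
  have sect: "(\<lambda>y. g (x, y)) \<in> borel_measurable borel" for x
    by measurable
  have inner: "(\<integral>y. F (x, y) \<partial>lebesgue) = (\<integral>y. g (x, y) \<partial>lborel)"
    if "AE y in lborel. F (x, y) = g (x, y)" for x
  proof -
    have ae: "AE y in lebesgue. F (x, y) = g (x, y)"
      using that by (rule AE_completion)
    have gx: "(\<lambda>y. g (x, y)) \<in> borel_measurable lebesgue"
      using sect[of x] by (auto intro!: measurable_completion)
    have Fx: "(\<lambda>y. F (x, y)) \<in> borel_measurable lebesgue"
      by (rule borel_measurable_AE[OF gx AE_eq_sym[OF ae]])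
    have "(\<integral>y. F (x, y) \<partial>lebesgue) = (\<integral>y. g (x, y) \<partial>lebesgue)"
      by (rule integral_cong_AE[OF Fx gx ae])
    also have "\<dots> = (\<integral>y. g (x, y) \<partial>lborel)"
      using sect[of x] by (intro integral_completion) simp
    finally show ?thesis .
  qed
  have "AE z in lborel \<Otimes>\<^sub>M lborel. F z = g z"
    unfolding lborel_prod by (rule Fg)
  then have "AE x in lborel. AE y in lborel. F (x, y) = g (x, y)"
    by (rule lborel_pair.AE_pair)
  then have "AE x in lborel. (\<integral>y. F (x, y) \<partial>lebesgue) = (\<integral>y. g (x, y) \<partial>lborel)"
    by eventually_elim (rule inner)
  then have outer: "AE x in lebesgue. (\<integral>y. F (x, y) \<partial>lebesgue) = (\<integral>y. g (x, y) \<partial>lborel)"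
    by (rule AE_completion)
  have Gb: "(\<lambda>x. \<integral>y. g (x, y) \<partial>lborel) \<in> borel_measurable lborel"
    by measurable
  then have Gl: "(\<lambda>x. \<integral>y. g (x, y) \<partial>lborel) \<in> borel_measurable lebesgue"
    by (rule measurable_completion)
  have Fl: "(\<lambda>x. \<integral>y. F (x, y) \<partial>lebesgue) \<in> borel_measurable lebesgue"
    by (rule borel_measurable_AE[OF Gl AE_eq_sym[OF outer]])
  have "(\<integral>x. (\<integral>y. F (x, y) \<partial>lebesgue) \<partial>lebesgue) = (\<integral>x. (\<integral>y. g (x, y) \<partial>lborel) \<partial>lebesgue)"
    by (rule integral_cong_AE[OF Fl Gl outer])
  also have "\<dots> = (\<integral>x. (\<integral>y. g (x, y) \<partial>lborel) \<partial>lborel)"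
    by (rule integral_completion[OF Gb])
  also have "\<dots> = (\<integral>z. g z \<partial>(lborel \<Otimes>\<^sub>M lborel))"
    by (rule lborel_pair.integral_fst'[OF gi])
  also have "\<dots> = (\<integral>z. g z \<partial>lebesgue)"
    by (simp add: lborel_prod integral_completion)
  also have "\<dots> = (\<integral>z. F z \<partial>lebesgue)"
    by (rule integral_cong_AE[OF gl Fm AE_eq_sym[OF Fg']])
  finally show ?thesis .
qed

lemma distr_lborel_swap:
  "distr lborel borel (\<lambda>z::'a::euclidean_space \<times> 'a. (snd z, fst z)) = lborel"
proof -
  have "distr lborel borel (\<lambda>z::'a \<times> 'a. (snd z, fst z))
      = distr (lborel \<Otimes>\<^sub>M lborel) (lborel \<Otimes>\<^sub>M lborel) (\<lambda>(x::'a, y::'a). (y, x))"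
    by (rule distr_cong) (auto simp: lborel_prod simp flip: borel_prod)
  also have "\<dots> = lborel \<Otimes>\<^sub>M lborel"
    by (rule lborel_pair.distr_pair_swap[symmetric])
  also have "\<dots> = lborel"
    by (rule lborel_prod)
  finally show ?thesis .
qed

section \<open>The kernel form on bounded continuous functions\<close>

definition bounded_continuous :: "('a::topological_space \<Rightarrow> real) \<Rightarrow> bool" where
  "bounded_continuous f \<longleftrightarrow> continuous_on UNIV f \<and> bounded (range f)"

lemma bounded_continuous_add:
  "bounded_continuous f \<Longrightarrow> bounded_continuous g \<Longrightarrow> bounded_continuous (\<lambda>x. f x + g x)"
  unfolding bounded_continuous_def
  by (auto intro: continuous_on_add bounded_plus_comp)

lemma bounded_continuous_scale:
  "bounded_continuous f \<Longrightarrow> bounded_continuous (\<lambda>x. c * f x)"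
  unfolding bounded_continuous_def
  using bounded_scaling[of "range f" c] by (auto intro: continuous_on_mult_left simp: image_image)

lemma bounded_continuous_shift:
  fixes f :: "'a::real_normed_vector \<Rightarrow> real"
  assumes "bounded_continuous f"
  shows "bounded_continuous (\<lambda>x. f (x + a))"
proof -
  have "bounded (range (\<lambda>x. f (x + a)))"
    using assms unfolding bounded_continuous_def by (auto intro: bounded_subset[of "range f"])
  moreover have "continuous_on UNIV (\<lambda>x. f (x + a))"
    by (rule continuous_on_compose2[where g = f and t = UNIV and f = "\<lambda>x. x + a"])
       (use assms in \<open>auto simp: bounded_continuous_def intro: continuous_intros\<close>)
  ultimately show ?thesis by (simp add: bounded_continuous_def)
qed

lemma bounded_continuous_tensor:
  assumes f: "bounded_continuous f" and g: "bounded_continuous g"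
  shows "bounded_continuous (\<lambda>z. f (fst z) * g (snd z))"
proof -
  obtain B where B: "\<And>x. \<bar>f x\<bar> \<le> B"
    using f unfolding bounded_continuous_def bounded_iff by auto
  obtain D where D: "\<And>x. \<bar>g x\<bar> \<le> D"
    using g unfolding bounded_continuous_def bounded_iff by auto
  have "\<bar>f (fst z) * g (snd z)\<bar> \<le> B * D" for z
    unfolding abs_mult using B[of "fst z"] D[of "snd z"] by (intro mult_mono) auto
  then have "bounded (range (\<lambda>z. f (fst z) * g (snd z)))"
    by (intro boundedI[of _ "B * D"]) auto
  moreover have "continuous_on UNIV (\<lambda>z. f (fst z) * g (snd z))"
    using f g unfolding bounded_continuous_def
    by (auto intro!: continuous_on_mult continuous_on_fst continuous_on_snd continuous_on_id
        intro: continuous_on_compose2[where g = f and t = UNIV and f = fst]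
          continuous_on_compose2[where g = g and t = UNIV and f = snd])
  ultimately show ?thesis unfolding bounded_continuous_def by simp
qed

lemma bounded_continuous_sum:
  "(\<And>p. p \<in> P \<Longrightarrow> bounded_continuous (f p)) \<Longrightarrow> bounded_continuous (\<lambda>x. \<Sum>p\<in>P. f p x)"
proof (induction P rule: infinite_finite_induct)
  case (insert a P)
  then show ?case using bounded_continuous_add[of "f a"] by simp
qed (auto simp: bounded_continuous_def image_constant_conv)

definition kernel_form ::
    "'a::euclidean_space set \<Rightarrow> ('a \<Rightarrow> 'a \<Rightarrow> real) \<Rightarrow> ('a \<Rightarrow> real) \<Rightarrow> ('a \<Rightarrow> real) \<Rightarrow> real" where
  "kernel_form \<Omega> A f g = (LINT x:\<Omega>|lebesgue. LINT x':\<Omega>|lebesgue. A x x' * f x * g x')"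

locale integrable_kernel =
  fixes \<Omega> :: "'a::euclidean_space set" and A :: "'a \<Rightarrow> 'a \<Rightarrow> real"
  assumes integrable: "set_integrable lebesgue (\<Omega> \<times> \<Omega>) (\<lambda>(x, x'). A x x')"
begin

text \<open>
  The kernel restricted to \<open>\<Omega> \<times> \<Omega>\<close>.  It is integrable on the whole space, where translations and
  the exchange of the two variables act.
\<close>

definition K :: "'a \<times> 'a \<Rightarrow> real" where
  "K z = indicator (\<Omega> \<times> \<Omega>) z * A (fst z) (snd z)"

lemma integrable_K: "integrable lebesgue K"
  using integrable unfolding set_integrable_def K_def by (simp add: case_prod_beta')

lemma integrable_K_times:
  assumes h: "bounded_continuous h"
  shows "integrable lebesgue (\<lambda>z. K z * h z)"
proof -
  obtain B where B: "\<And>z. \<bar>h z\<bar> \<le> B"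
    using h unfolding bounded_continuous_def bounded_iff by auto
  have hm: "h \<in> borel_measurable lebesgue"
    using h unfolding bounded_continuous_def
    by (auto intro!: measurable_completion borel_measurable_continuous_onI)
  have Km: "K \<in> borel_measurable lebesgue"
    using integrable_K by simp
  have "\<bar>K z * h z\<bar> \<le> norm (B * K z)" for z
    using B[of z] by (simp add: abs_mult mult.commute mult_right_mono order_trans[OF _ abs_ge_self])
  then have bound: "AE z in lebesgue. norm (K z * h z) \<le> norm (B * K z)"
    by simp
  have meas: "(\<lambda>z. K z * h z) \<in> borel_measurable lebesgue"
    using Km hm by (rule borel_measurable_times)
  have "integrable lebesgue (\<lambda>z. B * K z)"
    using integrable_K by simp
  then show ?thesis
    using meas bound by (rule Bochner_Integration.integrable_bound)
qed

lemma iterated_integral_eq: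
  assumes h: "bounded_continuous h"
  shows "(LINT x:\<Omega>|lebesgue. LINT x':\<Omega>|lebesgue. A x x' * h (x, x')) = (\<integral>z. K z * h z \<partial>lebesgue)"
proof -
  have "(LINT x:\<Omega>|lebesgue. LINT x':\<Omega>|lebesgue. A x x' * h (x, x'))
      = (\<integral>x. (\<integral>x'. K (x, x') * h (x, x') \<partial>lebesgue) \<partial>lebesgue)"
    unfolding set_lebesgue_integral_def K_def
    by (intro Bochner_Integration.integral_cong refl)
       (simp add: indicator_times mult.assoc)
  also have "\<dots> = (\<integral>z. K z * h z \<partial>lebesgue)"
    by (rule integral_lebesgue_iterated[OF integrable_K_times[OF h]])
  finally show ?thesis .
qed

lemma kernel_form_eq:
  assumes "bounded_continuous f" "bounded_continuous g"
  shows "kernel_form \<Omega> A f g = (\<integral>z. K z * (f (fst z) * g (snd z)) \<partial>lebesgue)"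
  using iterated_integral_eq[OF bounded_continuous_tensor[OF assms]]
  unfolding kernel_form_def mult.assoc fst_conv snd_conv .

lemma kernel_form_add_left:
  assumes f: "bounded_continuous f" and f': "bounded_continuous f'" and g: "bounded_continuous g"
  shows "kernel_form \<Omega> A (\<lambda>x. f x + f' x) g = kernel_form \<Omega> A f g + kernel_form \<Omega> A f' g"
proof -
  have "(\<integral>z. K z * ((f (fst z) + f' (fst z)) * g (snd z)) \<partial>lebesgue)
      = (\<integral>z. K z * (f (fst z) * g (snd z)) + K z * (f' (fst z) * g (snd z)) \<partial>lebesgue)"
    by (simp only: distrib_left distrib_right)
  also have "\<dots> = (\<integral>z. K z * (f (fst z) * g (snd z)) \<partial>lebesgue) + (\<integral>z. K z * (f' (fst z) * g (snd z)) \<partial>lebesgue)"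
    by (intro Bochner_Integration.integral_add integrable_K_times bounded_continuous_tensor f f' g)
  finally show ?thesis
    by (simp only: kernel_form_eq[OF f g] kernel_form_eq[OF f' g] kernel_form_eq[OF bounded_continuous_add[OF f f'] g])
qed

lemma kernel_form_add_right:
  assumes f: "bounded_continuous f" and g: "bounded_continuous g" and g': "bounded_continuous g'"
  shows "kernel_form \<Omega> A f (\<lambda>x. g x + g' x) = kernel_form \<Omega> A f g + kernel_form \<Omega> A f g'"
proof -
  have "(\<integral>z. K z * (f (fst z) * (g (snd z) + g' (snd z))) \<partial>lebesgue)
      = (\<integral>z. K z * (f (fst z) * g (snd z)) + K z * (f (fst z) * g' (snd z)) \<partial>lebesgue)"
    by (simp only: distrib_left)
  also have "\<dots> = (\<integral>z. K z * (f (fst z) * g (snd z)) \<partial>lebesgue) + (\<integral>z. K z * (f (fst z) * g' (snd z)) \<partial>lebesgue)"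
    by (intro Bochner_Integration.integral_add integrable_K_times bounded_continuous_tensor f g g')
  finally show ?thesis
    by (simp only: kernel_form_eq[OF f g] kernel_form_eq[OF f g'] kernel_form_eq[OF f bounded_continuous_add[OF g g']])
qed

lemma kernel_form_scale:
  shows kernel_form_scale_left: "kernel_form \<Omega> A (\<lambda>x. c * f x) g = c * kernel_form \<Omega> A f g"
    and kernel_form_scale_right: "kernel_form \<Omega> A f (\<lambda>x. c * g x) = c * kernel_form \<Omega> A f g"
proof -
  have "A x x' * (c * f x) * g x' = c * (A x x' * f x * g x')"
    "A x x' * f x * (c * g x') = c * (A x x' * f x * g x')" for x x'
    by simp_all
  then show "kernel_form \<Omega> A (\<lambda>x. c * f x) g = c * kernel_form \<Omega> A f g"
    "kernel_form \<Omega> A f (\<lambda>x. c * g x) = c * kernel_form \<Omega> A f g"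
    unfolding kernel_form_def by (simp_all only: set_integral_mult_right)
qed

lemma kernel_form_diff:
  assumes "bounded_continuous f" "bounded_continuous f'" "bounded_continuous g" "bounded_continuous g'"
  shows "kernel_form \<Omega> A (\<lambda>x. f x - f' x) (\<lambda>x. g x - g' x)
    = kernel_form \<Omega> A f g - kernel_form \<Omega> A f g' - kernel_form \<Omega> A f' g + kernel_form \<Omega> A f' g'"
proof -
  note neg = bounded_continuous_scale[where c = "-1"]
  have "kernel_form \<Omega> A (\<lambda>x. f x + - 1 * f' x) (\<lambda>x. g x + - 1 * g' x)
    = kernel_form \<Omega> A f g + - 1 * kernel_form \<Omega> A f g'
      + - 1 * (kernel_form \<Omega> A f' g + - 1 * kernel_form \<Omega> A f' g')"
    using assms by (simp only: kernel_form_add_left kernel_form_add_right kernel_form_scale neg bounded_continuous_add)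
  then show ?thesis by simp
qed

lemma iterated_integral_sum:
  assumes f: "\<And>p. p \<in> P \<Longrightarrow> bounded_continuous (f p)"
    and g: "\<And>p. p \<in> P \<Longrightarrow> bounded_continuous (g p)"
  shows "(LINT x:\<Omega>|lebesgue. LINT x':\<Omega>|lebesgue. A x x' * (\<Sum>p\<in>P. c p * (f p x * g p x')))
    = (\<Sum>p\<in>P. c p * kernel_form \<Omega> A (f p) (g p))"
proof -
  have cont: "bounded_continuous (\<lambda>z. c p * (f p (fst z) * g p (snd z)))" if "p \<in> P" for p
    using that f g by (intro bounded_continuous_scale bounded_continuous_tensor)
  have "(LINT x:\<Omega>|lebesgue. LINT x':\<Omega>|lebesgue. A x x' * (\<Sum>p\<in>P. c p * (f p x * g p x')))
      = (\<integral>z. K z * (\<Sum>p\<in>P. c p * (f p (fst z) * g p (snd z))) \<partial>lebesgue)"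
    using iterated_integral_eq[OF bounded_continuous_sum[OF cont]] unfolding fst_conv snd_conv .
  also have "\<dots> = (\<Sum>p\<in>P. \<integral>z. K z * (c p * (f p (fst z) * g p (snd z))) \<partial>lebesgue)"
    unfolding sum_distrib_left
    by (intro Bochner_Integration.integral_sum integrable_K_times cont)
  also have "\<dots> = (\<Sum>p\<in>P. c p * kernel_form \<Omega> A (f p) (g p))"
  proof (intro sum.cong refl)
    fix p assume p: "p \<in> P"
    have "(\<integral>z. K z * (c p * (f p (fst z) * g p (snd z))) \<partial>lebesgue) = (\<integral>z. c p * (K z * (f p (fst z) * g p (snd z))) \<partial>lebesgue)"
      by (simp only: mult.left_commute)
    also have "\<dots> = c p * kernel_form \<Omega> A (f p) (g p)"
      unfolding kernel_form_eq[OF f[OF p] g[OF p]] by (rule integral_mult_right_zero)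
    finally show "(\<integral>z. K z * (c p * (f p (fst z) * g p (snd z))) \<partial>lebesgue) = c p * kernel_form \<Omega> A (f p) (g p)" .
  qed
  finally show ?thesis .
qed

text \<open>
  Uniform bounds and pointwise convergence suffice: a multiple of \<open>\<bar>K\<bar>\<close> dominates.
\<close>

lemma kernel_form_tendsto:
  assumes cont: "bounded_continuous f" "bounded_continuous g"
    "\<And>k. bounded_continuous (fs k)" "\<And>k. bounded_continuous (gs k)"
    and bound: "\<And>k x. \<bar>fs k x\<bar> \<le> B" "\<And>k x. \<bar>gs k x\<bar> \<le> D"
    and lim: "\<And>x. (\<lambda>k::nat. fs k x) \<longlonglongrightarrow> f x" "\<And>x. (\<lambda>k. gs k x) \<longlonglongrightarrow> g x"
  shows "(\<lambda>k. kernel_form \<Omega> A (fs k) (gs k)) \<longlonglongrightarrow> kernel_form \<Omega> A f g"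
proof -
  have B0: "0 \<le> B" using bound(1)[of 0 undefined] by linarith
  have "(\<lambda>k. \<integral>z. K z * (fs k (fst z) * gs k (snd z)) \<partial>lebesgue)
      \<longlonglongrightarrow> (\<integral>z. K z * (f (fst z) * g (snd z)) \<partial>lebesgue)"
  proof (rule integral_dominated_convergence[where w = "\<lambda>z. \<bar>K z\<bar> * (B * D)"])
    show "(\<lambda>z. K z * (f (fst z) * g (snd z))) \<in> borel_measurable lebesgue"
      by (intro borel_measurable_integrable integrable_K_times bounded_continuous_tensor cont)
    show "(\<lambda>z. K z * (fs k (fst z) * gs k (snd z))) \<in> borel_measurable lebesgue" for k
      by (intro borel_measurable_integrable integrable_K_times bounded_continuous_tensor cont)
    show "integrable lebesgue (\<lambda>z. \<bar>K z\<bar> * (B * D))"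
      using integrable_K by simp
    show "AE z in lebesgue. (\<lambda>k. K z * (fs k (fst z) * gs k (snd z))) \<longlonglongrightarrow> K z * (f (fst z) * g (snd z))"
      by (intro AE_I2 tendsto_intros lim)
    show "AE z in lebesgue. norm (K z * (fs k (fst z) * gs k (snd z))) \<le> \<bar>K z\<bar> * (B * D)" for k
      unfolding real_norm_def abs_mult
      by (intro AE_I2 mult_left_mono mult_mono bound B0) auto
  qed
  then show ?thesis by (simp add: kernel_form_eq cont)
qed

lemma kernel_form_commute:
  assumes sym: "\<And>x x'. A x x' = A x' x" and f: "bounded_continuous f" and g: "bounded_continuous g"
  shows "kernel_form \<Omega> A f g = kernel_form \<Omega> A g f"
proof -
  have "(\<integral>z. K z * (f (fst z) * g (snd z)) \<partial>lebesgue)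
      = (\<integral>z. K (snd z, fst z) * (f (snd z) * g (fst z)) \<partial>lebesgue)"
    using integral_lebesgue_measure_preserving[OF _ distr_lborel_swap
        borel_measurable_integrable[OF integrable_K_times[OF bounded_continuous_tensor[OF f g]]]]
    by (simp add: borel_prod[symmetric])
  also have "\<dots> = (\<integral>z. K z * (g (fst z) * f (snd z)) \<partial>lebesgue)"
    by (intro Bochner_Integration.integral_cong refl)
       (auto simp: K_def sym[of "snd _" "fst _"] indicator_def)
  finally show ?thesis using f g by (simp add: kernel_form_eq)
qed

text \<open>
  A translation by the diagonal vector \<open>(a, a)\<close> preserves Lebesgue measure and the value of the
  kernel.  It does not preserve \<open>\<Omega> \<times> \<Omega>\<close>; the four support conditions say that neither the original
  nor the translated functions see the complement of \<open>\<Omega>\<close>.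
\<close>

lemma kernel_form_shift:
  assumes inv: "\<And>x x'. A (x + a) (x' + a) = A x x'"
    and f: "bounded_continuous f" and g: "bounded_continuous g"
    and supp: "{x. f x \<noteq> 0} \<subseteq> \<Omega>" "{x. g x \<noteq> 0} \<subseteq> \<Omega>"
      "{x. f (x + a) \<noteq> 0} \<subseteq> \<Omega>" "{x. g (x + a) \<noteq> 0} \<subseteq> \<Omega>"
  shows "kernel_form \<Omega> A (\<lambda>x. f (x + a)) (\<lambda>x. g (x + a)) = kernel_form \<Omega> A f g"
proof -
  let ?H = "\<lambda>z. K z * (f (fst z) * g (snd z))"
  have "(\<integral>z. K z * (f (fst z + a) * g (snd z + a)) \<partial>lebesgue) = (\<integral>z. ?H ((a, a) + z) \<partial>lebesgue)"
  proof (intro Bochner_Integration.integral_cong refl)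
    fix z :: "'a \<times> 'a"
    obtain x x' where z: "z = (x, x')" by (cases z)
    show "K z * (f (fst z + a) * g (snd z + a)) = ?H ((a, a) + z)"
    proof (cases "f (x + a) = 0 \<or> g (x' + a) = 0")
      case False
      then have "x \<in> \<Omega>" "x' \<in> \<Omega>" "x + a \<in> \<Omega>" "x' + a \<in> \<Omega>"
        using supp by auto
      then show ?thesis by (simp add: z K_def inv add.commute[of a])
    qed (auto simp: z add.commute[of a])
  qed
  also have "\<dots> = (\<integral>z. ?H z \<partial>lebesgue)"
  proof (rule integral_lebesgue_measure_preserving[OF _ lborel_distr_plus])
    show "?H \<in> borel_measurable lebesgue"
      by (intro borel_measurable_integrable integrable_K_times bounded_continuous_tensor f g)
  qed simp
  finally show ?thesis
    using f g by (simp add: kernel_form_eq bounded_continuous_shift)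
qed

end

section \<open>Test functions\<close>

lemma Ck_add: "Ck k f \<Longrightarrow> Ck k g \<Longrightarrow> Ck k (\<lambda>x. f x + g x)"
proof (induction k arbitrary: f g)
  case 0
  then show ?case by (auto intro: continuous_on_add)
next
  case (Suc k)
  have "(\<lambda>x. frechet_derivative (\<lambda>x. f x + g x) (at x) h)
      = (\<lambda>x. frechet_derivative f (at x) h + frechet_derivative g (at x) h)" for h
  proof
    fix x
    have "((\<lambda>x. f x + g x) has_derivative (\<lambda>h. frechet_derivative f (at x) h + frechet_derivative g (at x) h)) (at x)"
      using Suc.prems by (intro has_derivative_add) (simp_all add: frechet_derivative_works)
    then show "frechet_derivative (\<lambda>x. f x + g x) (at x) h
        = frechet_derivative f (at x) h + frechet_derivative g (at x) h"
      by (simp flip: frechet_derivative_at)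
  qed
  then show ?case
    using Suc by (auto intro: differentiable_add)
qed

lemma frechet_derivative_bounded_linear:
  assumes "bounded_linear L" "f differentiable (at x)"
  shows "frechet_derivative (\<lambda>x. L (f x)) (at x) h = L (frechet_derivative f (at x) h)"
proof -
  have "(f has_derivative frechet_derivative f (at x)) (at x)"
    using assms(2) by (simp add: frechet_derivative_works)
  from bounded_linear.has_derivative[OF assms(1) this]
  have "frechet_derivative (\<lambda>x. L (f x)) (at x) = (\<lambda>h. L (frechet_derivative f (at x) h))"
    by (rule frechet_derivative_at[symmetric])
  then show ?thesis by simp
qed

lemma differentiable_bounded_linear:
  assumes "bounded_linear L" "f differentiable (at x)"
  shows "(\<lambda>x. L (f x)) differentiable (at x)"
  using assms bounded_linear.has_derivative[OF assms(1)] unfolding differentiable_def by blast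

lemma Ck_bounded_linear:
  assumes L: "bounded_linear L"
  shows "Ck k f \<Longrightarrow> Ck k (\<lambda>x. L (f x))"
proof (induction k arbitrary: f)
  case 0
  then show ?case by (simp add: bounded_linear.continuous_on[OF L])
next
  case (Suc k)
  have "(\<lambda>x. frechet_derivative (\<lambda>x. L (f x)) (at x) h) = (\<lambda>x. L (frechet_derivative f (at x) h))" for h
    using Suc.prems by (simp add: frechet_derivative_bounded_linear[OF L])
  then show ?case
    using Suc by (simp add: differentiable_bounded_linear[OF L])
qed

lemma smooth_imp_differentiable: "smooth f \<Longrightarrow> f differentiable (at x)"
  unfolding smooth_def by (metis Ck.simps(2))

lemma smooth_directional_derivative:
  "smooth f \<Longrightarrow> smooth (\<lambda>x. frechet_derivative f (at x) h)"
  unfolding smooth_def by (metis Ck.simps(2))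

text \<open>
  Operations that do not enlarge the support only need their smoothness checked.
\<close>

lemma test_functionsI_support:
  assumes "smooth g" "f \<in> test_functions \<Omega>" "{x. g x \<noteq> 0} \<subseteq> closure {x. f x \<noteq> 0}"
  shows "g \<in> test_functions \<Omega>"
proof -
  have sub: "closure {x. g x \<noteq> 0} \<subseteq> closure {x. f x \<noteq> 0}"
    using assms(3) by (simp add: closure_minimal)
  moreover have "compact (closure {x. f x \<noteq> 0})" "closure {x. f x \<noteq> 0} \<subseteq> \<Omega>"
    using assms(2) by (auto simp: test_functions_def)
  ultimately have "compact (closure {x. g x \<noteq> 0})"
    by (meson bounded_subset closed_closure compact_eq_bounded_closed)
  then show ?thesis
    using assms(1) sub \<open>closure {x. f x \<noteq> 0} \<subseteq> \<Omega>\<close> by (auto simp: test_functions_def)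
qed

lemma test_functions_bounded_linear:
  assumes L: "bounded_linear L" and f: "f \<in> test_functions \<Omega>"
  shows "(\<lambda>x. L (f x)) \<in> test_functions \<Omega>"
proof (rule test_functionsI_support[OF _ f])
  show "smooth (\<lambda>x. L (f x))"
    using f Ck_bounded_linear[OF L] by (auto simp: test_functions_def smooth_def)
  show "{x. L (f x) \<noteq> 0} \<subseteq> closure {x. f x \<noteq> 0}"
    using closure_subset linear_0[OF bounded_linear.linear[OF L]] by fastforce
qed

lemma test_functions_add:
  assumes f: "f \<in> test_functions \<Omega>" and g: "g \<in> test_functions \<Omega>"
  shows "(\<lambda>x. f x + g x) \<in> test_functions \<Omega>"
proof -
  let ?S = "closure {x. f x \<noteq> 0} \<union> closure {x. g x \<noteq> 0}"
  have S: "compact ?S" "?S \<subseteq> \<Omega>"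
    using f g by (auto simp: test_functions_def intro: compact_Un)
  have "{x. f x + g x \<noteq> 0} \<subseteq> ?S"
    using closure_subset[of "{x. f x \<noteq> 0}"] closure_subset[of "{x. g x \<noteq> 0}"]
    by (smt (verit) Un_iff add.right_neutral mem_Collect_eq subset_iff)
  then have sub: "closure {x. f x + g x \<noteq> 0} \<subseteq> ?S"
    by (rule closure_minimal) (simp add: closed_Un)
  then have "compact (closure {x. f x + g x \<noteq> 0})"
    using S(1) by (meson bounded_subset closed_closure compact_eq_bounded_closed)
  moreover have "smooth (\<lambda>x. f x + g x)"
    using f g by (simp add: test_functions_def smooth_def Ck_add)
  ultimately show ?thesis
    using sub S(2) by (auto simp: test_functions_def)
qed

lemma test_functions_directional_derivative:
  assumes f: "f \<in> test_functions \<Omega>"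
  shows "(\<lambda>x. frechet_derivative f (at x) h) \<in> test_functions \<Omega>"
proof (rule test_functionsI_support[OF _ f])
  show "smooth (\<lambda>x. frechet_derivative f (at x) h)"
    using f smooth_directional_derivative by (auto simp: test_functions_def)
  show "{x. frechet_derivative f (at x) h \<noteq> 0} \<subseteq> closure {x. f x \<noteq> 0}"
  proof (rule subsetI, rule ccontr)
    fix x assume x: "x \<in> {x. frechet_derivative f (at x) h \<noteq> 0}" and nx: "x \<notin> closure {x. f x \<noteq> 0}"
    have "(f has_derivative (\<lambda>h. 0)) (at x)"
    proof (rule has_derivative_transform_within_open[where f = "\<lambda>x. 0" and s = "- closure {x. f x \<noteq> 0}"])
      show "0 = f y" if "y \<in> - closure {x. f x \<noteq> 0}" for y
        using that closure_subset[of "{x. f x \<noteq> 0}"] by auto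
    qed (use nx in auto)
    then have "frechet_derivative f (at x) = (\<lambda>h. 0)"
      by (rule frechet_derivative_at[symmetric])
    then show False using x by simp
  qed
qed

lemma test_functions_imp_bounded_continuous:
  fixes f :: "'a::euclidean_space \<Rightarrow> real"
  assumes f: "f \<in> test_functions \<Omega>"
  shows "bounded_continuous f"
proof -
  let ?S = "closure {x. f x \<noteq> 0}"
  have "Ck 0 f" and S: "compact ?S"
    using f unfolding test_functions_def smooth_def by blast+
  then have cont: "continuous_on UNIV f"
    by simp
  have "bounded (f ` ?S)"
    by (intro compact_imp_bounded compact_continuous_image S continuous_on_subset[OF cont]) simp
  moreover have "range f \<subseteq> insert 0 (f ` ?S)"
    using closure_subset[of "{x. f x \<noteq> 0}"] by auto
  ultimately have "bounded (range f)"
    using bounded_subset bounded_insert by blast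
  then show ?thesis using cont by (simp add: bounded_continuous_def)
qed

lemma test_functions_support: "f \<in> test_functions \<Omega> \<Longrightarrow> {x. f x \<noteq> 0} \<subseteq> \<Omega>"
  using closure_subset[of "{x. f x \<noteq> 0}"] by (auto simp: test_functions_def)

text \<open>
  A compact support has positive distance to the complement of \<open>\<Omega>\<close>, which leaves room for small
  translations.
\<close>

lemma test_functions_support_shift:
  fixes f :: "'a::euclidean_space \<Rightarrow> 'b::real_normed_vector"
  assumes f: "f \<in> test_functions \<Omega>" and \<Omega>: "open \<Omega>"
  obtains e where "e > 0" "\<And>a. norm a < e \<Longrightarrow> {x. f (x + a) \<noteq> 0} \<subseteq> \<Omega>"
proof -
  let ?S = "closure {x. f x \<noteq> 0}"
  have S: "compact ?S" "?S \<subseteq> \<Omega>"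
    using f by (auto simp: test_functions_def)
  obtain e where e: "e > 0" "(\<Union>x\<in>?S. ball x e) \<subseteq> \<Omega>"
    using compact_subset_open_imp_ball_epsilon_subset[OF S(1) \<Omega> S(2)] by blast
  have "{x. f (x + a) \<noteq> 0} \<subseteq> \<Omega>" if a: "norm a < e" for a
  proof
    fix x assume "x \<in> {x. f (x + a) \<noteq> 0}"
    then have "x + a \<in> ?S"
      using closure_subset[of "{x. f x \<noteq> 0}"] by auto
    moreover have "x \<in> ball (x + a) e"
      using a by (simp add: dist_norm)
    ultimately show "x \<in> \<Omega>" using e(2) by blast
  qed
  with e(1) show ?thesis using that by blast
qed

section \<open>Exchanging derivatives under a translation-invariant kernel\<close>

lemma line_derivative:
  fixes f :: "'a::real_normed_vector \<Rightarrow> real"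
  assumes "\<And>x. f differentiable (at x)"
  shows "((\<lambda>t. f (x + t *\<^sub>R d)) has_real_derivative frechet_derivative f (at (x + t *\<^sub>R d)) d) (at t)"
proof -
  let ?D = "frechet_derivative f (at (x + t *\<^sub>R d))"
  have D: "(f has_derivative ?D) (at (x + t *\<^sub>R d))"
    using assms by (simp add: frechet_derivative_works[symmetric])
  have "((\<lambda>t. f (x + t *\<^sub>R d)) has_derivative (\<lambda>s. ?D (s *\<^sub>R d))) (at t)"
    by (rule has_derivative_compose[where f = "\<lambda>t. x + t *\<^sub>R d" and g = f, OF _ D]) (auto intro!: derivative_eq_intros)
  moreover have "?D (s *\<^sub>R d) = ?D d * s" for s
    using linear_scale[OF has_derivative_linear[OF D]] by simp
  ultimately show ?thesis by (simp add: has_field_derivative_def)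
qed

lemma difference_quotient_tendsto:
  fixes f :: "'a::real_normed_vector \<Rightarrow> real"
  assumes diff: "\<And>x. f differentiable (at x)"
    and h: "h \<longlonglongrightarrow> 0" "\<And>k. h k \<noteq> 0"
  shows "(\<lambda>k. (f (x + h k *\<^sub>R d) - f x) / h k) \<longlonglongrightarrow> frechet_derivative f (at x) d"
proof -
  have "((\<lambda>t. (f (x + t *\<^sub>R d) - f x) / t) \<longlongrightarrow> frechet_derivative f (at x) d) (at 0)"
    using line_derivative[OF diff, where x = x and d = d and t = 0] by (simp add: DERIV_def)
  then show ?thesis
    using h filterlim_compose[of _ _ "at 0" h sequentially] by (simp add: filterlim_at)
qed

text \<open>
  The mean value inequality on the segment in direction \<open>d\<close>.  Uniformity in \<open>x\<close> and \<open>h\<close> is what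
  dominated convergence of the difference quotients requires.
\<close>

lemma difference_quotient_bound:
  fixes f :: "'a::real_normed_vector \<Rightarrow> real"
  assumes diff: "\<And>x. f differentiable (at x)"
    and bound: "\<And>x. \<bar>frechet_derivative f (at x) d\<bar> \<le> B"
  shows "\<bar>(f (x + h *\<^sub>R d) - f x) / h\<bar> \<le> B"
proof -
  have B: "0 \<le> B" using bound[of undefined] by linarith
  have "norm (f (x + h *\<^sub>R d) - f (x + 0 *\<^sub>R d)) \<le> B * norm (h - 0)"
    by (rule field_differentiable_bound[where S = UNIV and f' = "\<lambda>t. frechet_derivative f (at (x + t *\<^sub>R d)) d"])
       (use line_derivative[OF diff] bound in auto)
  then show ?thesis
    using B by (cases "h = 0") (simp_all add: divide_le_eq)
qed

text \<open>
  For a translation-invariant kernel, two directional derivatives in the two arguments may be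
  exchanged.  Formally this is two integrations by parts, but difference quotients prove it
  directly and without second derivatives.  Put \<open>D\<^sub>v f (x) = (f (x + h v) - f x) / h\<close> and let
  \<open>D\<^bsub>-v\<^esub>\<close> be the quotient for the step \<open>-h\<close>.  Multiplied out, \<open>T (D\<^sub>d f) (D\<^sub>e g)\<close> and
  \<open>T (D\<^bsub>-e\<^esub> f) (D\<^bsub>-d\<^esub> g)\<close> have four terms each, and a common translation of both
  arguments matches them one by one: each pair depends only on the difference of the two shifts.
  As \<open>h\<close> tends to 0, the two sides converge to the two sides of the claim.
\<close>

lemma (in integrable_kernel) kernel_form_swap_derivatives:
  fixes f g :: "'a \<Rightarrow> real"
  assumes \<Omega>: "open \<Omega>" and inv: "\<And>a x x'. A (x + a) (x' + a) = A x x'"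
    and f: "f \<in> test_functions \<Omega>" and g: "g \<in> test_functions \<Omega>"
  shows "kernel_form \<Omega> A (\<lambda>x. frechet_derivative f (at x) d) (\<lambda>x. frechet_derivative g (at x) e)
    = kernel_form \<Omega> A (\<lambda>x. frechet_derivative f (at x) e) (\<lambda>x. frechet_derivative g (at x) d)"
proof -
  let ?T = "kernel_form \<Omega> A"
  define Dq where "Dq v h u = (\<lambda>x. (u (x + h *\<^sub>R v) - u x) / h)" for v :: 'a and h :: real and u :: "'a \<Rightarrow> real"
  obtain r where r: "r > 0" "\<And>a. norm a < r \<Longrightarrow> {x. f (x + a) \<noteq> 0} \<subseteq> \<Omega>"
    by (rule test_functions_support_shift[OF f \<Omega>]) blast
  obtain s where s: "s > 0" "\<And>a. norm a < s \<Longrightarrow> {x. g (x + a) \<noteq> 0} \<subseteq> \<Omega>"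
    by (rule test_functions_support_shift[OF g \<Omega>]) blast
  \<comment> \<open>With these step sizes every shift occurring below has norm less than both \<open>r\<close> and \<open>s\<close>.\<close>
  define c where "c = min r s / (norm d + norm e + 1)"
  define h where "h k = c / real (Suc k)" for k
  have pos: "0 < norm d + norm e + 1"
    using norm_ge_zero[of d] norm_ge_zero[of e] by linarith
  have c: "c > 0" using r(1) s(1) pos by (simp add: c_def)
  have h: "h k \<noteq> 0" "0 < h k" "h k \<le> c" for k
    using c by (simp_all add: h_def divide_le_eq mult_le_cancel_left1)
  have h0: "h \<longlonglongrightarrow> 0"
    using LIMSEQ_Suc[OF lim_const_over_n[of c]] by (simp add: h_def[abs_def])
  have small: "norm (t *\<^sub>R d + u *\<^sub>R e) < min r s" if "\<bar>t\<bar> \<le> h k" "\<bar>u\<bar> \<le> h k" for t u k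
  proof -
    have "norm (t *\<^sub>R d + u *\<^sub>R e) \<le> \<bar>t\<bar> * norm d + \<bar>u\<bar> * norm e"
      using norm_triangle_ineq[of "t *\<^sub>R d" "u *\<^sub>R e"] by simp
    also have "\<dots> \<le> c * norm d + c * norm e"
      using that h(3)[of k] by (intro add_mono mult_right_mono) auto
    also have "\<dots> < c * (norm d + norm e + 1)"
      using c by (simp add: distrib_left)
    also have "\<dots> = min r s"
      using pos by (simp add: c_def)
    finally show ?thesis .
  qed
  have supp: "{x. f (x + a) \<noteq> 0} \<subseteq> \<Omega>" "{x. g (x + a) \<noteq> 0} \<subseteq> \<Omega>"
    if "a = t *\<^sub>R d + u *\<^sub>R e" "\<bar>t\<bar> \<le> h k" "\<bar>u\<bar> \<le> h k" for a t u k
    using small[OF that(2,3)] r(2)[of a] s(2)[of a] that(1) by auto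
  note bcf = test_functions_imp_bounded_continuous[OF f] and bcg = test_functions_imp_bounded_continuous[OF g]
  note bc = bcf bcg bounded_continuous_shift[OF bcf] bounded_continuous_shift[OF bcg]
  have shift: "?T (\<lambda>x. f (x + (a + b))) (\<lambda>x. g (x + (a' + b))) = ?T (\<lambda>x. f (x + a)) (\<lambda>x. g (x + a'))"
    if "{x. f (x + a) \<noteq> 0} \<subseteq> \<Omega>" "{x. g (x + a') \<noteq> 0} \<subseteq> \<Omega>"
      "{x. f (x + (a + b)) \<noteq> 0} \<subseteq> \<Omega>" "{x. g (x + (a' + b)) \<noteq> 0} \<subseteq> \<Omega>" for a a' b
    using kernel_form_shift[of b "\<lambda>x. f (x + a)" "\<lambda>x. g (x + a')"] inv bc(3,4) that
    by (simp add: ac_simps)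
  have quot: "?T (Dq d (h k) f) (Dq e (h k) g) = ?T (Dq e (- h k) f) (Dq d (- h k) g)" for k
  proof -
    let ?h = "h k"
    note supp' = supp[where k = k]
    have h0: "\<bar>0\<bar> \<le> ?h" "\<bar>?h\<bar> \<le> ?h" "\<bar>- ?h\<bar> \<le> ?h" using h(2)[of k] by simp_all
    have z: "{x. f x \<noteq> 0} \<subseteq> \<Omega>" "{x. g x \<noteq> 0} \<subseteq> \<Omega>"
      by (rule test_functions_support[OF f], rule test_functions_support[OF g])
    have sd: "{x. f (x + ?h *\<^sub>R d) \<noteq> 0} \<subseteq> \<Omega>" "{x. g (x + ?h *\<^sub>R d) \<noteq> 0} \<subseteq> \<Omega>"
      using supp'[of "?h *\<^sub>R d" ?h 0] h0 by auto
    have se: "{x. f (x + ?h *\<^sub>R e) \<noteq> 0} \<subseteq> \<Omega>" "{x. g (x + ?h *\<^sub>R e) \<noteq> 0} \<subseteq> \<Omega>"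
      using supp'[of "?h *\<^sub>R e" 0 ?h] h0 by auto
    have md: "{x. f (x + - ?h *\<^sub>R d) \<noteq> 0} \<subseteq> \<Omega>" "{x. g (x + - ?h *\<^sub>R d) \<noteq> 0} \<subseteq> \<Omega>"
      using supp'[of "- ?h *\<^sub>R d" "- ?h" 0] h0 by auto
    have me: "{x. f (x + - ?h *\<^sub>R e) \<noteq> 0} \<subseteq> \<Omega>" "{x. g (x + - ?h *\<^sub>R e) \<noteq> 0} \<subseteq> \<Omega>"
      using supp'[of "- ?h *\<^sub>R e" 0 "- ?h"] h0 by auto
    have de: "{x. f (x + (?h *\<^sub>R d + - ?h *\<^sub>R e)) \<noteq> 0} \<subseteq> \<Omega>"
      using supp'(1)[of "?h *\<^sub>R d + - ?h *\<^sub>R e" ?h "- ?h"] h0 by auto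
    \<comment> \<open>In the first two facts both sides have the relative shift \<open>h d - h e\<close>.\<close>
    have 1: "?T (\<lambda>x. f (x + ?h *\<^sub>R d)) (\<lambda>x. g (x + ?h *\<^sub>R e)) = ?T (\<lambda>x. f (x + (?h *\<^sub>R d + - ?h *\<^sub>R e))) g"
      using shift[of "?h *\<^sub>R d" "?h *\<^sub>R e" "- ?h *\<^sub>R e"] sd se z de by simp
    have 2: "?T (\<lambda>x. f (x + - ?h *\<^sub>R e)) (\<lambda>x. g (x + - ?h *\<^sub>R d)) = ?T (\<lambda>x. f (x + (?h *\<^sub>R d + - ?h *\<^sub>R e))) g"
      using shift[of "- ?h *\<^sub>R e" "- ?h *\<^sub>R d" "?h *\<^sub>R d"] md me z de by (simp add: add.commute)
    have 3: "?T f (\<lambda>x. g (x + - ?h *\<^sub>R d)) = ?T (\<lambda>x. f (x + ?h *\<^sub>R d)) g"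
      using shift[of 0 "- ?h *\<^sub>R d" "?h *\<^sub>R d"] md sd z by simp
    have 4: "?T f (\<lambda>x. g (x + ?h *\<^sub>R e)) = ?T (\<lambda>x. f (x + - ?h *\<^sub>R e)) g"
      using shift[of 0 "?h *\<^sub>R e" "- ?h *\<^sub>R e"] me se z by simp
    have Dq: "Dq v t u = (\<lambda>x. (1 / t) * (u (x + t *\<^sub>R v) - u x))" for v t u
      by (simp add: Dq_def)
    show ?thesis
      unfolding Dq kernel_form_scale
        kernel_form_diff[OF bc(3,1) bc(4,2)] 1 2 3 4
      by (simp add: algebra_simps)
  qed
  have Dq_bc: "bounded_continuous (Dq v t u)" if "bounded_continuous u" for v t u
    using bounded_continuous_scale[OF bounded_continuous_add[OF bounded_continuous_shift[OF that] bounded_continuous_scale[OF that, of "- 1"]], of "1 / t" "t *\<^sub>R v"]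
    by (simp add: Dq_def diff_divide_distrib right_diff_distrib)
  have diff: "f differentiable (at x)" "g differentiable (at x)" for x
    using f g smooth_imp_differentiable by (auto simp: test_functions_def)
  have dbc: "bounded_continuous (\<lambda>x. frechet_derivative f (at x) v)"
    "bounded_continuous (\<lambda>x. frechet_derivative g (at x) v)" for v
    by (intro test_functions_imp_bounded_continuous[where \<Omega> = \<Omega>] test_functions_directional_derivative f g)+
  have lim: "(\<lambda>k. ?T (Dq v (t k) f) (Dq w (t k) g))
      \<longlonglongrightarrow> ?T (\<lambda>x. frechet_derivative f (at x) v) (\<lambda>x. frechet_derivative g (at x) w)"
    if t: "t \<longlonglongrightarrow> 0" "\<And>k. t k \<noteq> 0" for t v w
  proof -
    obtain B where B: "\<And>x. \<bar>frechet_derivative f (at x) v\<bar> \<le> B"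
      using dbc(1)[of v] unfolding bounded_continuous_def bounded_iff by auto
    obtain D where D: "\<And>x. \<bar>frechet_derivative g (at x) w\<bar> \<le> D"
      using dbc(2)[of w] unfolding bounded_continuous_def bounded_iff by auto
    show ?thesis
    proof (rule kernel_form_tendsto[where B = B and D = D])
      show "\<bar>Dq v (t k) f x\<bar> \<le> B" for k x
        unfolding Dq_def by (rule difference_quotient_bound[OF diff(1) B])
      show "\<bar>Dq w (t k) g x\<bar> \<le> D" for k x
        unfolding Dq_def by (rule difference_quotient_bound[OF diff(2) D])
      show "(\<lambda>k. Dq v (t k) f x) \<longlonglongrightarrow> frechet_derivative f (at x) v" for x
        unfolding Dq_def by (rule difference_quotient_tendsto[OF diff(1) t])
      show "(\<lambda>k. Dq w (t k) g x) \<longlonglongrightarrow> frechet_derivative g (at x) w" for x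
        unfolding Dq_def by (rule difference_quotient_tendsto[OF diff(2) t])
    qed (intro dbc Dq_bc bcf bcg)+
  qed
  have "(\<lambda>k. - h k) \<longlonglongrightarrow> 0" using tendsto_minus[OF h0] by simp
  then show ?thesis
    using LIMSEQ_unique[OF lim[OF h0 h(1)] lim[of "\<lambda>k. - h k" e d, folded quot]] h(1) by simp
qed

section \<open>Entry sums of Schur products\<close>

lemma psd_zero_diagonal:
  fixes q b c :: real
  assumes nonneg: "\<And>t. 0 \<le> q * t\<^sup>2 + 2 * b * t + c" and "q = 0"
  shows "b = 0"
proof (rule ccontr)
  assume b: "b \<noteq> 0"
  have "0 \<le> 2 * b * (- (c + 1) / (2 * b)) + c"
    using nonneg[of "- (c + 1) / (2 * b)"] \<open>q = 0\<close> by simp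
  also have "\<dots> = -1" using b by simp
  finally show False by simp
qed

lemma double_sum_insert:
  fixes F :: "'i \<Rightarrow> 'i \<Rightarrow> real"
  assumes "finite I" "a \<notin> I"
  shows "(\<Sum>i\<in>insert a I. \<Sum>j\<in>insert a I. F i j)
    = F a a + (\<Sum>j\<in>I. F a j) + (\<Sum>i\<in>I. F i a) + (\<Sum>i\<in>I. \<Sum>j\<in>I. F i j)"
  using assms by (simp add: sum.distrib)

text \<open>
  The proof is Gaussian elimination on \<open>Q\<close>, one index at a time.  Splitting off the row and column of \<open>a\<close> writes \<open>Q\<close> as the rank-one
  matrix with entries \<open>Q a i * Q a j / Q a a\<close> plus a Schur complement \<open>Q'\<close> supported on the remaining
  indices.  The rank-one part contributes a value of the quadratic form of \<open>G\<close>, and the induction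
  hypothesis covers \<open>Q'\<close>.
\<close>

lemma Schur_product_sum_nonneg:
  fixes Q G :: "'i \<Rightarrow> 'i \<Rightarrow> real"
  assumes "finite I"
    and Qsym: "\<And>i j. i \<in> I \<Longrightarrow> j \<in> I \<Longrightarrow> Q i j = Q j i"
    and Qpsd: "\<And>x. 0 \<le> (\<Sum>i\<in>I. \<Sum>j\<in>I. Q i j * x i * x j)"
    and Gpsd: "\<And>x. 0 \<le> (\<Sum>i\<in>I. \<Sum>j\<in>I. G i j * x i * x j)"
  shows "0 \<le> (\<Sum>i\<in>I. \<Sum>j\<in>I. Q i j * G i j)"
  using assms
proof (induction I arbitrary: Q rule: finite_induct)
  case empty
  then show ?case by simp
next
  case (insert a I)
  note Qsym = insert.prems(1) and Qpsd = insert.prems(2) and Gpsd = insert.prems(3)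
  let ?q = "Q a a"
  have expand: "(\<Sum>i\<in>insert a I. \<Sum>j\<in>insert a I. Q i j * x i * x j)
      = ?q * (x a)\<^sup>2 + 2 * (\<Sum>j\<in>I. Q a j * x j) * x a + (\<Sum>i\<in>I. \<Sum>j\<in>I. Q i j * x i * x j)" for x
  proof -
    have "(\<Sum>i\<in>I. Q i a * x i * x a) = (\<Sum>j\<in>I. Q a j * x a * x j)"
      by (intro sum.cong refl) (simp add: Qsym[of a] insert.hyps)
    then show ?thesis
      unfolding double_sum_insert[OF insert.hyps(1,2)]
      by (simp add: power2_eq_square sum_distrib_left sum_distrib_right mult_ac)
  qed
  have q0: "0 \<le> ?q"
  proof -
    define e where "e i = (if i = a then 1 else 0 :: real)" for i
    have "e i = 0" if "i \<in> I" for i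
      using that insert.hyps by (auto simp: e_def)
    then have "(\<Sum>j\<in>I. Q a j * e j) = 0" "(\<Sum>i\<in>I. \<Sum>j\<in>I. Q i j * e i * e j) = 0"
      by (simp_all cong: sum.cong)
    moreover have "e a = 1" by (simp add: e_def)
    ultimately show ?thesis using Qpsd[of e] unfolding expand by simp
  qed
  \<comment> \<open>A vanishing pivot forces its row to vanish.  Since division by 0 gives 0, the elimination
    formulas then hold without a case distinction.\<close>
  have row: "Q a j = 0" if "?q = 0" "j \<in> I" for j
  proof -
    have "0 \<le> ?q * t\<^sup>2 + 2 * Q a j * t + Q j j" for t
    proof -
      define y where "y i = (if i = a then t else if i = j then 1 else 0)" for i
      have ya: "y a = t" by (simp add: y_def)
      have yI: "y i = (if i = j then 1 else 0)" if "i \<in> I" for i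
        using that insert.hyps by (auto simp: y_def)
      have "(\<Sum>k\<in>I. Q a k * y k) = (\<Sum>k\<in>I. if k = j then Q a j else 0)"
        by (intro sum.cong refl) (simp add: yI)
      then have 1: "(\<Sum>k\<in>I. Q a k * y k) = Q a j"
        using \<open>j \<in> I\<close> insert.hyps by simp
      have "(\<Sum>i\<in>I. \<Sum>k\<in>I. Q i k * y i * y k) = (\<Sum>i\<in>I. \<Sum>k\<in>I. if k = j then (if i = j then Q j j else 0) else 0)"
        by (intro sum.cong refl) (simp add: yI)
      also have "\<dots> = Q j j"
        using \<open>j \<in> I\<close> insert.hyps by simp
      finally have 2: "(\<Sum>i\<in>I. \<Sum>k\<in>I. Q i k * y i * y k) = Q j j" .
      show ?thesis
        using Qpsd[of y] unfolding expand 1 2 ya by simp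
    qed
    then show ?thesis using \<open>?q = 0\<close> by (rule psd_zero_diagonal)
  qed
  have row_div: "?q * (Q a j / ?q) = Q a j" if "j \<in> I" for j
    using row[OF _ that] by (cases "?q = 0") auto
  define Q' where "Q' i j = Q i j - Q a i * Q a j / ?q" for i j
  have Q'psd: "0 \<le> (\<Sum>i\<in>I. \<Sum>j\<in>I. Q' i j * x i * x j)" for x
  proof -
    let ?s = "\<Sum>j\<in>I. Q a j * x j"
    \<comment> \<open>The value at \<open>a\<close> minimises the quadratic form of \<open>Q\<close> over all extensions of \<open>x\<close>.\<close>
    let ?y = "\<lambda>i. if i = a then - ?s / ?q else x i"
    have y: "?y i = x i" if "i \<in> I" for i
      using that insert.hyps by auto
    have s: "?q * (?s / ?q) = ?s"
    proof -
      have "?s = 0" if "?q = 0" using row[OF that] by simp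
      then show ?thesis by (cases "?q = 0") auto
    qed
    have "(\<Sum>i\<in>I. \<Sum>j\<in>I. Q' i j * x i * x j)
        = (\<Sum>i\<in>I. \<Sum>j\<in>I. Q i j * x i * x j) - (\<Sum>i\<in>I. \<Sum>j\<in>I. (Q a i * x i) * (Q a j * x j) / ?q)"
      unfolding sum_subtractf[symmetric]
      by (intro sum.cong refl) (simp add: Q'_def left_diff_distrib right_diff_distrib mult_ac)
    also have "(\<Sum>i\<in>I. \<Sum>j\<in>I. (Q a i * x i) * (Q a j * x j) / ?q) = ?s * ?s / ?q"
      by (simp add: sum_product sum_divide_distrib)
    finally have 1: "(\<Sum>i\<in>I. \<Sum>j\<in>I. Q' i j * x i * x j) = (\<Sum>i\<in>I. \<Sum>j\<in>I. Q i j * x i * x j) - ?s * ?s / ?q" .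
    have "(\<Sum>j\<in>I. Q a j * ?y j) = ?s" "(\<Sum>i\<in>I. \<Sum>j\<in>I. Q i j * ?y i * ?y j) = (\<Sum>i\<in>I. \<Sum>j\<in>I. Q i j * x i * x j)"
      using y by (auto intro!: sum.cong)
    then have "0 \<le> ?q * (- ?s / ?q)\<^sup>2 + 2 * ?s * (- ?s / ?q) + (\<Sum>i\<in>I. \<Sum>j\<in>I. Q i j * x i * x j)"
      using Qpsd[of ?y] unfolding expand by simp
    moreover have "?q * (- ?s / ?q)\<^sup>2 = ?s * ?s / ?q"
      by (cases "?q = 0") (simp_all add: power2_eq_square)
    ultimately show ?thesis unfolding 1 by simp
  qed
  have Q'sym: "Q' i j = Q' j i" if "i \<in> I" "j \<in> I" for i j
    using that Qsym[of i j] by (simp add: Q'_def mult.commute)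
  have "0 \<le> (\<Sum>i\<in>I. \<Sum>j\<in>I. G i j * x i * x j)" for x
  proof -
    define y where "y i = (if i = a then 0 else x i)" for i
    have "y a = 0" by (simp add: y_def)
    moreover have "y i = x i" if "i \<in> I" for i
      using that insert.hyps by (auto simp: y_def)
    ultimately show ?thesis
      using Gpsd[of y] unfolding double_sum_insert[OF insert.hyps(1,2)] by (simp cong: sum.cong)
  qed
  then have Q'G: "0 \<le> (\<Sum>i\<in>I. \<Sum>j\<in>I. Q' i j * G i j)"
    by (intro insert.IH Q'sym Q'psd)
  have "0 \<le> (\<Sum>i\<in>insert a I. \<Sum>j\<in>insert a I. G i j * Q a i * Q a j) / ?q"
    using Gpsd[of "Q a"] q0 by simp
  moreover have "(\<Sum>i\<in>insert a I. \<Sum>j\<in>insert a I. Q i j * G i j)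
      = (\<Sum>i\<in>insert a I. \<Sum>j\<in>insert a I. G i j * Q a i * Q a j) / ?q + (\<Sum>i\<in>I. \<Sum>j\<in>I. Q' i j * G i j)"
  proof -
    have "(\<Sum>i\<in>insert a I. \<Sum>j\<in>insert a I. G i j * Q a i * Q a j) / ?q
        = (\<Sum>i\<in>insert a I. \<Sum>j\<in>insert a I. G i j * Q a i * Q a j / ?q)"
      by (simp add: sum_divide_distrib)
    also have "\<dots> = G a a * ?q + (\<Sum>j\<in>I. G a j * Q a j) + (\<Sum>i\<in>I. G i a * Q a i)
        + (\<Sum>i\<in>I. \<Sum>j\<in>I. G i j * Q a i * Q a j / ?q)"
    proof -
      have "G a j * Q a a * Q a j / ?q = G a j * Q a j" "G j a * Q a j * Q a a / ?q = G j a * Q a j" if "j \<in> I" for j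
        using row_div[OF that] by (auto simp: mult_ac)
      then show ?thesis
        unfolding double_sum_insert[OF insert.hyps(1,2)] by simp
    qed
    finally have 1: "(\<Sum>i\<in>insert a I. \<Sum>j\<in>insert a I. G i j * Q a i * Q a j) / ?q
        = G a a * ?q + (\<Sum>j\<in>I. G a j * Q a j) + (\<Sum>i\<in>I. G i a * Q a i)
          + (\<Sum>i\<in>I. \<Sum>j\<in>I. G i j * Q a i * Q a j / ?q)" .
    have 2: "(\<Sum>i\<in>I. \<Sum>j\<in>I. Q' i j * G i j)
        = (\<Sum>i\<in>I. \<Sum>j\<in>I. Q i j * G i j) - (\<Sum>i\<in>I. \<Sum>j\<in>I. G i j * Q a i * Q a j / ?q)"
      unfolding sum_subtractf[symmetric]
      by (intro sum.cong refl) (simp add: Q'_def left_diff_distrib)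
    have 3: "(\<Sum>i\<in>I. Q i a * G i a) = (\<Sum>i\<in>I. G i a * Q a i)"
    proof (intro sum.cong refl)
      fix i assume "i \<in> I"
      then have "Q i a = Q a i" by (intro Qsym) auto
      then show "Q i a * G i a = G i a * Q a i" by simp
    qed
    have 4: "(\<Sum>j\<in>I. Q a j * G a j) = (\<Sum>j\<in>I. G a j * Q a j)"
      by (simp add: mult.commute)
    show ?thesis
      unfolding 1 2 unfolding double_sum_insert[OF insert.hyps(1,2)] 3 4 by simp
  qed
  ultimately show ?case using Q'G by simp
qed

section \<open>Semi-inner products on function spaces and their completions\<close>

text \<open>
  Null vectors of \<open>p\<close> are admitted because the completion identifies them with 0.
\<close>

locale semi_inner_form =
  fixes S :: "('x \<Rightarrow> 'b::real_vector) set" and p :: "('x \<Rightarrow> 'b) \<Rightarrow> ('x \<Rightarrow> 'b) \<Rightarrow> real"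
  assumes add_closed: "u \<in> S \<Longrightarrow> v \<in> S \<Longrightarrow> (\<lambda>x. u x + v x) \<in> S"
    and scale_closed: "u \<in> S \<Longrightarrow> (\<lambda>x. c *\<^sub>R u x) \<in> S"
    and add_left: "u \<in> S \<Longrightarrow> v \<in> S \<Longrightarrow> w \<in> S \<Longrightarrow> p (\<lambda>x. u x + v x) w = p u w + p v w"
    and scale_left: "u \<in> S \<Longrightarrow> w \<in> S \<Longrightarrow> p (\<lambda>x. c *\<^sub>R u x) w = c * p u w"
    and commute: "u \<in> S \<Longrightarrow> w \<in> S \<Longrightarrow> p u w = p w u"
    and nonneg: "u \<in> S \<Longrightarrow> 0 \<le> p u u"
begin

abbreviation nrm :: "('x \<Rightarrow> 'b) \<Rightarrow> real" where "nrm \<equiv> form_norm p"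

lemma diff_closed: "u \<in> S \<Longrightarrow> v \<in> S \<Longrightarrow> (\<lambda>x. u x - v x) \<in> S"
  using add_closed[OF _ scale_closed[of v "-1"], of u] by simp

lemma add_right: "u \<in> S \<Longrightarrow> v \<in> S \<Longrightarrow> w \<in> S \<Longrightarrow> p w (\<lambda>x. u x + v x) = p w u + p w v"
  by (simp add: commute[of w] add_left add_closed)

lemma scale_right: "u \<in> S \<Longrightarrow> w \<in> S \<Longrightarrow> p w (\<lambda>x. c *\<^sub>R u x) = c * p w u"
  by (simp add: commute[of w] scale_left scale_closed)

lemma form_norm_nonneg: "u \<in> S \<Longrightarrow> 0 \<le> nrm u"
  by (simp add: form_norm_def nonneg)

lemma form_norm_square: "u \<in> S \<Longrightarrow> (nrm u)\<^sup>2 = p u u"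
  by (simp add: form_norm_def nonneg)

lemma Cauchy_Schwarz:
  assumes u: "u \<in> S" and v: "v \<in> S"
  shows "\<bar>p u v\<bar> \<le> nrm u * nrm v"
proof -
  have quad: "0 \<le> p u u * t\<^sup>2 + 2 * p u v * t + p v v" for t
    using nonneg[OF add_closed[OF scale_closed[OF u, of t] v]] u v
    by (simp add: add_left add_right scale_left scale_right scale_closed add_closed
        commute[of v u] power2_eq_square algebra_simps)
  have "(p u v)\<^sup>2 \<le> p u u * p v v"
  proof (cases "p u u = 0")
    case True
    have "p u v = 0"
      using quad True by (rule psd_zero_diagonal)
    then show ?thesis using True by simp
  next
    case False
    then have pos: "0 < p u u" using nonneg[OF u] by simp
    have "0 \<le> p v v - (p u v)\<^sup>2 / p u u"
      using quad[of "- p u v / p u u"] pos by (simp add: power2_eq_square field_simps)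
    then show ?thesis using pos by (simp add: field_simps)
  qed
  also have "\<dots> = (nrm u * nrm v)\<^sup>2"
    by (simp add: power_mult_distrib form_norm_square u v)
  finally have "\<bar>p u v\<bar>\<^sup>2 \<le> (nrm u * nrm v)\<^sup>2" by simp
  then show ?thesis
    by (rule power2_le_imp_le) (simp add: form_norm_nonneg u v)
qed

lemma form_norm_triangle:
  assumes u: "u \<in> S" and v: "v \<in> S"
  shows "nrm (\<lambda>x. u x + v x) \<le> nrm u + nrm v"
proof -
  have "(nrm (\<lambda>x. u x + v x))\<^sup>2 = p u u + 2 * p u v + p v v"
    using u v by (simp add: form_norm_square add_closed add_left add_right commute[of v u])
  also have "\<dots> \<le> (nrm u)\<^sup>2 + 2 * (nrm u * nrm v) + (nrm v)\<^sup>2"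
    using Cauchy_Schwarz[OF u v] by (simp add: form_norm_square u v)
  also have "\<dots> = (nrm u + nrm v)\<^sup>2"
    by (simp add: power2_sum)
  finally show ?thesis
    by (rule power2_le_imp_le) (simp add: form_norm_nonneg u v)
qed

lemma form_norm_scale: "u \<in> S \<Longrightarrow> nrm (\<lambda>x. c *\<^sub>R u x) = \<bar>c\<bar> * nrm u"
  by (simp add: form_norm_def scale_left scale_right scale_closed real_sqrt_mult mult.assoc[symmetric])

lemma form_norm_diff_commute: "u \<in> S \<Longrightarrow> v \<in> S \<Longrightarrow> nrm (\<lambda>x. u x - v x) = nrm (\<lambda>x. v x - u x)"
  using form_norm_scale[OF diff_closed[of u v], of "-1"] by simp

lemma form_norm_diff_triangle:
  assumes "u \<in> S" "v \<in> S" "w \<in> S"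
  shows "nrm (\<lambda>x. u x - w x) \<le> nrm (\<lambda>x. u x - v x) + nrm (\<lambda>x. v x - w x)"
  using form_norm_triangle[OF diff_closed[of u v] diff_closed[of v w]] assms by simp

lemma form_norm_diff_bound:
  assumes u: "u \<in> S" and v: "v \<in> S"
  shows "\<bar>nrm u - nrm v\<bar> \<le> nrm (\<lambda>x. u x - v x)"
  using form_norm_triangle[OF diff_closed[OF u v] v] form_norm_triangle[OF diff_closed[OF v u] u]
    form_norm_diff_commute[OF u v] by simp

lemma sum_closed:
  "finite I \<Longrightarrow> I \<noteq> {} \<Longrightarrow> (\<And>i. i \<in> I \<Longrightarrow> u i \<in> S) \<Longrightarrow> (\<lambda>x. \<Sum>i\<in>I. c i *\<^sub>R u i x) \<in> S"
proof (induction I rule: finite_ne_induct)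
  case (singleton a)
  then show ?case by (simp add: scale_closed)
next
  case (insert a I)
  then show ?case using add_closed[OF scale_closed[of "u a" "c a"]] by simp
qed

lemma sum_left:
  "finite I \<Longrightarrow> I \<noteq> {} \<Longrightarrow> (\<And>i. i \<in> I \<Longrightarrow> u i \<in> S) \<Longrightarrow> w \<in> S \<Longrightarrow>
    p (\<lambda>x. \<Sum>i\<in>I. c i *\<^sub>R u i x) w = (\<Sum>i\<in>I. c i * p (u i) w)"
proof (induction I rule: finite_ne_induct)
  case (singleton a)
  then show ?case by (simp add: scale_left)
next
  case (insert a I)
  then show ?case
    using add_left[OF scale_closed[of "u a" "c a"] sum_closed[of I u c]] by (simp add: scale_left)
qed

text \<open>
  The quadratic form of the Gram matrix at \<open>c\<close> is the value of \<open>p\<close> at the linear combination of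
  the \<open>u i\<close> with coefficients \<open>c i\<close>.
\<close>

lemma Gram_nonneg:
  assumes I: "finite I" and u: "\<And>i. i \<in> I \<Longrightarrow> u i \<in> S"
  shows "0 \<le> (\<Sum>i\<in>I. \<Sum>j\<in>I. p (u i) (u j) * c i * c j)"
proof (cases "I = {}")
  case False
  define s where "s = (\<lambda>x. \<Sum>i\<in>I. c i *\<^sub>R u i x)"
  have s: "s \<in> S" unfolding s_def by (rule sum_closed[OF I False u])
  have "p s s = (\<Sum>i\<in>I. c i * p (u i) s)"
    unfolding s_def[THEN arg_cong, of "\<lambda>t. p t s"] by (rule sum_left[OF I False u s])
  also have "\<dots> = (\<Sum>i\<in>I. c i * (\<Sum>j\<in>I. c j * p (u j) (u i)))"
  proof (intro sum.cong refl)
    fix i assume i: "i \<in> I"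
    have "p (u i) s = p s (u i)" by (rule commute[OF u[OF i] s])
    also have "\<dots> = (\<Sum>j\<in>I. c j * p (u j) (u i))"
      unfolding s_def by (rule sum_left[OF I False u u[OF i]])
    finally show "c i * p (u i) s = c i * (\<Sum>j\<in>I. c j * p (u j) (u i))" by simp
  qed
  also have "\<dots> = (\<Sum>i\<in>I. \<Sum>j\<in>I. p (u i) (u j) * c i * c j)"
    unfolding sum_distrib_left by (intro sum.cong refl) (simp add: commute u mult_ac)
  finally show ?thesis using nonneg[OF s] by simp
qed simp

lemma cauchy_seqsD: "u \<in> cauchy_seqs S p \<Longrightarrow> u k \<in> S"
  by (simp add: cauchy_seqs_def)

lemma Bseq_form_norm:
  assumes u: "u \<in> cauchy_seqs S p"
  shows "Bseq (\<lambda>k. nrm (u k))"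
proof -
  have "Cauchy (\<lambda>k. nrm (u k))"
    unfolding Cauchy_def dist_real_def
  proof (intro allI impI)
    fix e :: real assume "e > 0"
    then obtain N where "\<forall>j\<ge>N. \<forall>k\<ge>N. nrm (\<lambda>x. u j x - u k x) < e"
      using u by (auto simp: cauchy_seqs_def)
    then show "\<exists>N. \<forall>j\<ge>N. \<forall>k\<ge>N. \<bar>nrm (u j) - nrm (u k)\<bar> < e"
      using form_norm_diff_bound[OF cauchy_seqsD[OF u] cauchy_seqsD[OF u]] order_le_less_trans by blast
  qed
  then show ?thesis by (simp add: Cauchy_convergent convergent_imp_Bseq)
qed

lemma form_norm_add_diff_le:
  assumes "u \<in> S" "u' \<in> S" "v \<in> S" "v' \<in> S"
  shows "nrm (\<lambda>x. (u x + v x) - (u' x + v' x)) \<le> nrm (\<lambda>x. u x - u' x) + nrm (\<lambda>x. v x - v' x)"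
  using form_norm_triangle[OF diff_closed[of u u'] diff_closed[of v v']] assms
  by (simp add: algebra_simps)

lemma cauchy_seqs_add:
  assumes u: "u \<in> cauchy_seqs S p" and v: "v \<in> cauchy_seqs S p"
  shows "(\<lambda>k x. u k x + v k x) \<in> cauchy_seqs S p"
  unfolding cauchy_seqs_def
proof (intro CollectI conjI allI impI)
  show "(\<lambda>x. u k x + v k x) \<in> S" for k
    by (intro add_closed cauchy_seqsD[OF u] cauchy_seqsD[OF v])
  fix e :: real assume e: "e > 0"
  obtain N where N: "\<And>j k. j \<ge> N \<Longrightarrow> k \<ge> N \<Longrightarrow> nrm (\<lambda>x. u j x - u k x) < e / 2"
    using u half_gt_zero[OF e] unfolding cauchy_seqs_def by blast
  obtain M where M: "\<And>j k. j \<ge> M \<Longrightarrow> k \<ge> M \<Longrightarrow> nrm (\<lambda>x. v j x - v k x) < e / 2"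
    using v half_gt_zero[OF e] unfolding cauchy_seqs_def by blast
  have "nrm (\<lambda>x. u j x + v j x - (u k x + v k x)) < e" if "j \<ge> max N M" "k \<ge> max N M" for j k
    using form_norm_add_diff_le[OF cauchy_seqsD[OF u, of j] cauchy_seqsD[OF u, of k] cauchy_seqsD[OF v, of j] cauchy_seqsD[OF v, of k]]
      N[of j k] M[of j k] that by simp
  then show "\<exists>N. \<forall>j\<ge>N. \<forall>k\<ge>N. nrm (\<lambda>x. u j x + v j x - (u k x + v k x)) < e"
    by blast
qed

lemma cauchy_seqs_scale:
  assumes u: "u \<in> cauchy_seqs S p"
  shows "(\<lambda>k x. c *\<^sub>R u k x) \<in> cauchy_seqs S p"
  unfolding cauchy_seqs_def
proof (intro CollectI conjI allI impI)
  show "(\<lambda>x. c *\<^sub>R u k x) \<in> S" for k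
    by (intro scale_closed cauchy_seqsD[OF u])
  fix e :: real assume e: "e > 0"
  then have "e / (\<bar>c\<bar> + 1) > 0" by simp
  then obtain N where N: "\<And>j k. j \<ge> N \<Longrightarrow> k \<ge> N \<Longrightarrow> nrm (\<lambda>x. u j x - u k x) < e / (\<bar>c\<bar> + 1)"
    using u unfolding cauchy_seqs_def by blast
  have "nrm (\<lambda>x. c *\<^sub>R u j x - c *\<^sub>R u k x) < e" if "j \<ge> N" "k \<ge> N" for j k
  proof -
    have d: "(\<lambda>x. u j x - u k x) \<in> S"
      by (intro diff_closed cauchy_seqsD[OF u])
    have "nrm (\<lambda>x. c *\<^sub>R u j x - c *\<^sub>R u k x) = \<bar>c\<bar> * nrm (\<lambda>x. u j x - u k x)"
      using form_norm_scale[OF d, of c] by (simp add: scaleR_diff_right)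
    also have "\<dots> \<le> (\<bar>c\<bar> + 1) * nrm (\<lambda>x. u j x - u k x)"
      using form_norm_nonneg[OF d] by (intro mult_right_mono) auto
    also have "\<dots> < e"
      using N[OF that] by (simp add: pos_less_divide_eq mult.commute)
    finally show ?thesis .
  qed
  then show "\<exists>N. \<forall>j\<ge>N. \<forall>k\<ge>N. nrm (\<lambda>x. c *\<^sub>R u j x - c *\<^sub>R u k x) < e"
    by blast
qed

lemma equiv_null_equiv: "equiv (cauchy_seqs S p) (null_equiv S p)"
proof (rule equivI)
  show "null_equiv S p \<subseteq> cauchy_seqs S p \<times> cauchy_seqs S p"
    by (auto simp: null_equiv_def)
  show "refl_on (cauchy_seqs S p) (null_equiv S p)"
  proof (rule refl_onI)
    fix u assume u: "u \<in> cauchy_seqs S p"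
    have "nrm (\<lambda>x. 0) = 0"
      using form_norm_scale[OF cauchy_seqsD[OF u], of 0] by simp
    then show "(u, u) \<in> null_equiv S p"
      using u by (simp add: null_equiv_def)
  qed
  show "sym (null_equiv S p)"
  proof (rule symI)
    fix u v assume uv: "(u, v) \<in> null_equiv S p"
    then have "nrm (\<lambda>x. u k x - v k x) = nrm (\<lambda>x. v k x - u k x)" for k
      by (intro form_norm_diff_commute) (auto simp: null_equiv_def cauchy_seqsD)
    with uv show "(v, u) \<in> null_equiv S p"
      by (simp add: null_equiv_def)
  qed
  show "trans (null_equiv S p)"
  proof (rule transI)
    fix u v w assume uv: "(u, v) \<in> null_equiv S p" and vw: "(v, w) \<in> null_equiv S p"
    have mem: "u k \<in> S" "v k \<in> S" "w k \<in> S" for k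
      using uv vw by (auto simp: null_equiv_def cauchy_seqsD)
    have "(\<lambda>k. nrm (\<lambda>x. u k x - v k x) + nrm (\<lambda>x. v k x - w k x)) \<longlonglongrightarrow> 0"
      using uv vw by (intro tendsto_add_zero) (auto simp: null_equiv_def)
    then have "(\<lambda>k. nrm (\<lambda>x. u k x - w k x)) \<longlonglongrightarrow> 0"
    proof (rule Lim_null_comparison[rotated], intro always_eventually allI)
      show "norm (nrm (\<lambda>x. u k x - w k x)) \<le> nrm (\<lambda>x. u k x - v k x) + nrm (\<lambda>x. v k x - w k x)" for k
        using form_norm_diff_triangle[OF mem] form_norm_nonneg[OF diff_closed[OF mem(1,3)]] by simp
    qed
    then show "(u, w) \<in> null_equiv S p"
      using uv vw by (auto simp: null_equiv_def)
  qed
qed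

lemma completion_obtain:
  assumes "U \<in> hilbert_completion S p"
  obtains u where "u \<in> U" "u \<in> cauchy_seqs S p" "U = null_equiv S p `` {u}"
  using assms equiv_class_self[OF equiv_null_equiv]
  unfolding hilbert_completion_def quotient_def by blast

lemma completion_reps:
  assumes "U \<in> hilbert_completion S p" "u \<in> U"
  shows "u \<in> cauchy_seqs S p"
    and "u' \<in> U \<Longrightarrow> (u, u') \<in> null_equiv S p"
  using assms in_quotient_imp_subset[OF equiv_null_equiv] quotient_eq_iff[OF equiv_null_equiv]
  unfolding hilbert_completion_def by blast+

lemma class_in_completion:
  assumes "u \<in> cauchy_seqs S p"
  shows "null_equiv S p `` {u} \<in> hilbert_completion S p" "u \<in> null_equiv S p `` {u}"
  using assms equiv_class_self[OF equiv_null_equiv] unfolding hilbert_completion_def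
  by (auto intro: quotientI)

lemma null_equiv_add:
  assumes "(u, u') \<in> null_equiv S p" "(v, v') \<in> null_equiv S p"
  shows "(\<lambda>k x. u k x + v k x, \<lambda>k x. u' k x + v' k x) \<in> null_equiv S p"
proof -
  have cs: "u \<in> cauchy_seqs S p" "u' \<in> cauchy_seqs S p" "v \<in> cauchy_seqs S p" "v' \<in> cauchy_seqs S p"
    using assms by (auto simp: null_equiv_def)
  note mem = cs[THEN cauchy_seqsD]
  have "(\<lambda>k. nrm (\<lambda>x. u k x - u' k x) + nrm (\<lambda>x. v k x - v' k x)) \<longlonglongrightarrow> 0"
    using assms by (intro tendsto_add_zero) (auto simp: null_equiv_def)
  then have "(\<lambda>k. nrm (\<lambda>x. (u k x + v k x) - (u' k x + v' k x))) \<longlonglongrightarrow> 0"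
  proof (rule Lim_null_comparison[rotated], intro always_eventually allI)
    show "norm (nrm (\<lambda>x. (u k x + v k x) - (u' k x + v' k x)))
        \<le> nrm (\<lambda>x. u k x - u' k x) + nrm (\<lambda>x. v k x - v' k x)" for k
      using form_norm_add_diff_le[OF mem, of k k k k]
        form_norm_nonneg[OF diff_closed[OF add_closed[OF mem(1,3)] add_closed[OF mem(2,4)]], of k k k k]
      by simp
  qed
  then show ?thesis
    using cs by (simp add: null_equiv_def cauchy_seqs_add)
qed

lemma null_equiv_scale:
  assumes "(u, u') \<in> null_equiv S p"
  shows "(\<lambda>k x. c *\<^sub>R u k x, \<lambda>k x. c *\<^sub>R u' k x) \<in> null_equiv S p"
proof -
  have cs: "u \<in> cauchy_seqs S p" "u' \<in> cauchy_seqs S p"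
    using assms by (auto simp: null_equiv_def)
  have "nrm (\<lambda>x. c *\<^sub>R u k x - c *\<^sub>R u' k x) = \<bar>c\<bar> * nrm (\<lambda>x. u k x - u' k x)" for k
    using form_norm_scale[OF diff_closed[OF cs[THEN cauchy_seqsD]], of c k k]
    by (simp add: scaleR_diff_right)
  moreover have "(\<lambda>k. \<bar>c\<bar> * nrm (\<lambda>x. u k x - u' k x)) \<longlonglongrightarrow> 0"
    using assms by (intro tendsto_mult_right_zero) (auto simp: null_equiv_def)
  ultimately show ?thesis
    using cs by (simp add: null_equiv_def cauchy_seqs_scale)
qed

text \<open>
  The union in the definition of \<open>completion_add\<close> runs over equal classes, so the sum of any two
  representatives represents the sum.
\<close>

lemma completion_add:
  assumes U: "U \<in> hilbert_completion S p" "u \<in> U" and V: "V \<in> hilbert_completion S p" "v \<in> V"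
  shows "completion_add S p U V \<in> hilbert_completion S p"
    and "(\<lambda>k x. u k x + v k x) \<in> completion_add S p U V"
proof -
  have "null_equiv S p `` {\<lambda>k x. u' k x + v' k x} = null_equiv S p `` {\<lambda>k x. u k x + v k x}"
    if "u' \<in> U" "v' \<in> V" for u' v'
    using equiv_class_eq[OF equiv_null_equiv null_equiv_add[OF completion_reps(2)[OF U(1) that(1) U(2)] completion_reps(2)[OF V(1) that(2) V(2)]]] .
  then have eq: "completion_add S p U V = null_equiv S p `` {\<lambda>k x. u k x + v k x}"
    using U(2) V(2) unfolding completion_add_def by blast
  have "(\<lambda>k x. u k x + v k x) \<in> cauchy_seqs S p"
    using completion_reps(1) U V by (intro cauchy_seqs_add) auto
  then show "completion_add S p U V \<in> hilbert_completion S p"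
    "(\<lambda>k x. u k x + v k x) \<in> completion_add S p U V"
    unfolding eq by (rule class_in_completion)+
qed

lemma completion_scale:
  assumes U: "U \<in> hilbert_completion S p" "u \<in> U"
  shows "completion_scale S p c U \<in> hilbert_completion S p"
    and "(\<lambda>k x. c *\<^sub>R u k x) \<in> completion_scale S p c U"
proof -
  have "null_equiv S p `` {\<lambda>k x. c *\<^sub>R u' k x} = null_equiv S p `` {\<lambda>k x. c *\<^sub>R u k x}"
    if "u' \<in> U" for u'
    using equiv_class_eq[OF equiv_null_equiv null_equiv_scale[OF completion_reps(2)[OF U(1) that U(2)]]] .
  then have eq: "completion_scale S p c U = null_equiv S p `` {\<lambda>k x. c *\<^sub>R u k x}"
    using U(2) unfolding completion_scale_def by blast
  have "(\<lambda>k x. c *\<^sub>R u k x) \<in> cauchy_seqs S p"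
    using completion_reps(1)[OF U] by (rule cauchy_seqs_scale)
  then show "completion_scale S p c U \<in> hilbert_completion S p"
    "(\<lambda>k x. c *\<^sub>R u k x) \<in> completion_scale S p c U"
    unfolding eq by (rule class_in_completion)+
qed

end

text \<open>
  Boundedness makes \<open>F\<close> uniformly continuous on
  bounded sets, so it maps Cauchy sequences to Cauchy sequences and does not see null sequences.
\<close>

locale bounded_form = semi_inner_form S p
  for S :: "('x \<Rightarrow> 'b::real_vector) set" and p :: "('x \<Rightarrow> 'b) \<Rightarrow> ('x \<Rightarrow> 'b) \<Rightarrow> real" +
  fixes F :: "('x \<Rightarrow> 'b) \<Rightarrow> ('x \<Rightarrow> 'b) \<Rightarrow> real" and B :: real
  assumes F_add_left: "u \<in> S \<Longrightarrow> v \<in> S \<Longrightarrow> w \<in> S \<Longrightarrow> F (\<lambda>x. u x + v x) w = F u w + F v w"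
    and F_add_right: "u \<in> S \<Longrightarrow> v \<in> S \<Longrightarrow> w \<in> S \<Longrightarrow> F w (\<lambda>x. u x + v x) = F w u + F w v"
    and F_scale_left: "u \<in> S \<Longrightarrow> w \<in> S \<Longrightarrow> F (\<lambda>x. c *\<^sub>R u x) w = c * F u w"
    and F_scale_right: "u \<in> S \<Longrightarrow> w \<in> S \<Longrightarrow> F w (\<lambda>x. c *\<^sub>R u x) = c * F w u"
    and F_bound: "u \<in> S \<Longrightarrow> w \<in> S \<Longrightarrow> \<bar>F u w\<bar> \<le> B * nrm u * nrm w"
begin

lemma F_diff_bound:
  assumes "u \<in> S" "u' \<in> S" "w \<in> S" "w' \<in> S"
  shows "\<bar>F u w - F u' w'\<bar> \<le> B * nrm (\<lambda>x. u x - u' x) * nrm w + B * nrm u' * nrm (\<lambda>x. w x - w' x)"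
proof -
  have "F (\<lambda>x. u x - u' x) w = F u w - F u' w"
    using F_add_left[OF _ scale_closed, of u u' w "-1"] F_scale_left[of u' w "-1"] assms by simp
  moreover have "F u' (\<lambda>x. w x - w' x) = F u' w - F u' w'"
    using F_add_right[OF _ scale_closed, of w w' u' "-1"] F_scale_right[of w' u' "-1"] assms by simp
  ultimately show ?thesis
    using F_bound[OF diff_closed, of u u' w] F_bound[OF _ diff_closed, of u' w w'] assms by linarith
qed

lemma Cauchy_F:
  assumes u: "u \<in> cauchy_seqs S p" and w: "w \<in> cauchy_seqs S p"
  shows "Cauchy (\<lambda>k. F (u k) (w k))"
proof (rule metric_CauchyI)
  fix e :: real assume e: "e > 0"
  obtain M where M: "M > 0" "\<And>k. nrm (u k) \<le> M"
    using Bseq_form_norm[OF u] by (auto simp: Bseq_def abs_le_iff)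
  obtain M' where M': "M' > 0" "\<And>k. nrm (w k) \<le> M'"
    using Bseq_form_norm[OF w] by (auto simp: Bseq_def abs_le_iff)
  define d where "d = e / (2 * (\<bar>B\<bar> + 1) * (M + M'))"
  have d: "d > 0" using e M M' by (simp add: d_def)
  obtain N where N: "\<And>j k. j \<ge> N \<Longrightarrow> k \<ge> N \<Longrightarrow> nrm (\<lambda>x. u j x - u k x) < d"
    using u d unfolding cauchy_seqs_def by blast
  obtain N' where N': "\<And>j k. j \<ge> N' \<Longrightarrow> k \<ge> N' \<Longrightarrow> nrm (\<lambda>x. w j x - w k x) < d"
    using w d unfolding cauchy_seqs_def by blast
  note mu = cauchy_seqsD[OF u] and mw = cauchy_seqsD[OF w]
  have "dist (F (u j) (w j)) (F (u k) (w k)) < e" if "j \<ge> max N N'" "k \<ge> max N N'" for j k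
  proof -
    have 1: "B * nrm (\<lambda>x. u j x - u k x) * nrm (w j) \<le> (\<bar>B\<bar> + 1) * d * M'"
      using N[of j k] M' that form_norm_nonneg[OF diff_closed[OF mu mu]] form_norm_nonneg[OF mw] d
      by (intro mult_mono) (auto intro: less_imp_le)
    have 2: "B * nrm (u k) * nrm (\<lambda>x. w j x - w k x) \<le> (\<bar>B\<bar> + 1) * M * d"
      using N'[of j k] M that form_norm_nonneg[OF diff_closed[OF mw mw]] form_norm_nonneg[OF mu] d
      by (intro mult_mono) (auto intro: less_imp_le)
    have "\<bar>F (u j) (w j) - F (u k) (w k)\<bar> \<le> (\<bar>B\<bar> + 1) * d * M' + (\<bar>B\<bar> + 1) * M * d"
      using F_diff_bound[OF mu[of j] mu[of k] mw[of j] mw[of k]] 1 2 by linarith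
    also have "\<dots> = e / 2"
      using M M' by (simp add: d_def divide_simps) (simp add: algebra_simps)
    finally show ?thesis using e by (simp add: dist_real_def)
  qed
  then show "\<exists>N. \<forall>j\<ge>N. \<forall>k\<ge>N. dist (F (u j) (w j)) (F (u k) (w k)) < e"
    by blast
qed

lemma F_null_equiv:
  assumes u: "(u, u') \<in> null_equiv S p" and w: "(w, w') \<in> null_equiv S p"
  shows "(\<lambda>k. F (u k) (w k) - F (u' k) (w' k)) \<longlonglongrightarrow> 0"
proof -
  have cs: "u \<in> cauchy_seqs S p" "u' \<in> cauchy_seqs S p" "w \<in> cauchy_seqs S p" "w' \<in> cauchy_seqs S p"
    using u w by (auto simp: null_equiv_def)
  have z: "(\<lambda>k. nrm (\<lambda>x. u k x - u' k x)) \<longlonglongrightarrow> 0" "(\<lambda>k. nrm (\<lambda>x. w k x - w' k x)) \<longlonglongrightarrow> 0"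
    using u w by (auto simp: null_equiv_def)
  have "(\<lambda>k. nrm (\<lambda>x. u k x - u' k x) * nrm (w k)) \<longlonglongrightarrow> 0"
    using bounded_bilinear.Zfun_prod_Bfun[OF bounded_bilinear_mult, of "\<lambda>k. nrm (\<lambda>x. u k x - u' k x)" sequentially "\<lambda>k. nrm (w k)"]
      z(1) Bseq_form_norm[OF cs(3)] by (simp add: tendsto_Zfun_iff)
  moreover have "(\<lambda>k. nrm (u' k) * nrm (\<lambda>x. w k x - w' k x)) \<longlonglongrightarrow> 0"
    using bounded_bilinear.Bfun_prod_Zfun[OF bounded_bilinear_mult, of "\<lambda>k. nrm (u' k)" sequentially "\<lambda>k. nrm (\<lambda>x. w k x - w' k x)"]
      z(2) Bseq_form_norm[OF cs(2)] by (simp add: tendsto_Zfun_iff)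
  ultimately have "(\<lambda>k. B * (nrm (\<lambda>x. u k x - u' k x) * nrm (w k)) + B * (nrm (u' k) * nrm (\<lambda>x. w k x - w' k x))) \<longlonglongrightarrow> 0"
    by (intro tendsto_add_zero tendsto_mult_right_zero)
  then show ?thesis
  proof (rule Lim_null_comparison[rotated], intro always_eventually allI)
    show "norm (F (u k) (w k) - F (u' k) (w' k))
      \<le> B * (nrm (\<lambda>x. u k x - u' k x) * nrm (w k)) + B * (nrm (u' k) * nrm (\<lambda>x. w k x - w' k x))" for k
      using F_diff_bound[OF cs[THEN cauchy_seqsD], of k k k k] by (simp add: mult.assoc)
  qed
qed

lemma form_ext_tendsto:
  assumes U: "U \<in> hilbert_completion S p" "u \<in> U" and W: "W \<in> hilbert_completion S p" "w \<in> W"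
  shows "(\<lambda>k. F (u k) (w k)) \<longlonglongrightarrow> form_ext F U W"
proof -
  obtain l where l: "(\<lambda>k. F (u k) (w k)) \<longlonglongrightarrow> l"
    using Cauchy_F[OF completion_reps(1)[OF U] completion_reps(1)[OF W]]
    by (auto simp: Cauchy_convergent_iff convergent_def)
  have all: "(\<lambda>k. F (u' k) (w' k)) \<longlonglongrightarrow> l" if "u' \<in> U" "w' \<in> W" for u' w'
    using tendsto_diff[OF l F_null_equiv[OF completion_reps(2)[OF U that(1)] completion_reps(2)[OF W that(2)]]]
    by simp
  have "form_ext F U W = l"
    unfolding form_ext_def
  proof (rule the_equality)
    show "\<forall>u\<in>U. \<forall>w\<in>W. (\<lambda>k. F (u k) (w k)) \<longlonglongrightarrow> l" using all by blast
    show "l' = l" if "\<forall>u\<in>U. \<forall>w\<in>W. (\<lambda>k. F (u k) (w k)) \<longlonglongrightarrow> l'" for l'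
      using that U(2) W(2) l LIMSEQ_unique by blast
  qed
  then show ?thesis using l by simp
qed

lemma extends_continuously: "extends_continuously S p F"
  unfolding extends_continuously_def using form_ext_tendsto by blast

lemma bilinear_on_completion: "bilinear_on_completion S p (form_ext F)"
  unfolding bilinear_on_completion_def
proof (intro conjI ballI allI)
  fix U V W assume UVW: "U \<in> hilbert_completion S p" "V \<in> hilbert_completion S p" "W \<in> hilbert_completion S p"
  obtain u where u: "u \<in> U" "u \<in> cauchy_seqs S p" using UVW(1) by (rule completion_obtain)
  obtain v where v: "v \<in> V" "v \<in> cauchy_seqs S p" using UVW(2) by (rule completion_obtain)
  obtain w where w: "w \<in> W" "w \<in> cauchy_seqs S p" using UVW(3) by (rule completion_obtain)
  note mem = u(2)[THEN cauchy_seqsD] v(2)[THEN cauchy_seqsD] w(2)[THEN cauchy_seqsD]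
  note sum = completion_add[OF UVW(1) u(1) UVW(2) v(1)]
  show "form_ext F (completion_add S p U V) W = form_ext F U W + form_ext F V W"
  proof (rule LIMSEQ_unique)
    show "(\<lambda>k. F (\<lambda>x. u k x + v k x) (w k)) \<longlonglongrightarrow> form_ext F (completion_add S p U V) W"
      by (rule form_ext_tendsto[OF sum UVW(3) w(1)])
    show "(\<lambda>k. F (\<lambda>x. u k x + v k x) (w k)) \<longlonglongrightarrow> form_ext F U W + form_ext F V W"
      unfolding F_add_left[OF mem]
      by (intro tendsto_add form_ext_tendsto UVW u v w)
  qed
  show "form_ext F W (completion_add S p U V) = form_ext F W U + form_ext F W V"
  proof (rule LIMSEQ_unique)
    show "(\<lambda>k. F (w k) (\<lambda>x. u k x + v k x)) \<longlonglongrightarrow> form_ext F W (completion_add S p U V)"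
      by (rule form_ext_tendsto[OF UVW(3) w(1) sum])
    show "(\<lambda>k. F (w k) (\<lambda>x. u k x + v k x)) \<longlonglongrightarrow> form_ext F W U + form_ext F W V"
      unfolding F_add_right[OF mem]
      by (intro tendsto_add form_ext_tendsto UVW u v w)
  qed
next
  fix c :: real and U W assume UW: "U \<in> hilbert_completion S p" "W \<in> hilbert_completion S p"
  obtain u where u: "u \<in> U" "u \<in> cauchy_seqs S p" using UW(1) by (rule completion_obtain)
  obtain w where w: "w \<in> W" "w \<in> cauchy_seqs S p" using UW(2) by (rule completion_obtain)
  note mem = u(2)[THEN cauchy_seqsD] w(2)[THEN cauchy_seqsD]
  note sc = completion_scale[OF UW(1) u(1), of c]
  show "form_ext F (completion_scale S p c U) W = c * form_ext F U W"
  proof (rule LIMSEQ_unique)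
    show "(\<lambda>k. F (\<lambda>x. c *\<^sub>R u k x) (w k)) \<longlonglongrightarrow> form_ext F (completion_scale S p c U) W"
      by (rule form_ext_tendsto[OF sc UW(2) w(1)])
    show "(\<lambda>k. F (\<lambda>x. c *\<^sub>R u k x) (w k)) \<longlonglongrightarrow> c * form_ext F U W"
      unfolding F_scale_left[OF mem] by (intro tendsto_mult_left form_ext_tendsto UW u w)
  qed
  show "form_ext F W (completion_scale S p c U) = c * form_ext F W U"
  proof (rule LIMSEQ_unique)
    show "(\<lambda>k. F (w k) (\<lambda>x. c *\<^sub>R u k x)) \<longlonglongrightarrow> form_ext F W (completion_scale S p c U)"
      by (rule form_ext_tendsto[OF UW(2) w(1) sc])
    show "(\<lambda>k. F (w k) (\<lambda>x. c *\<^sub>R u k x)) \<longlonglongrightarrow> c * form_ext F W U"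
      unfolding F_scale_right[OF mem] by (intro tendsto_mult_left form_ext_tendsto UW u w)
  qed
qed

end

section \<open>Matrices, stiffness tensors and gradients\<close>

abbreviation entry :: "real^'n^'n \<Rightarrow> 'n \<times> 'n \<Rightarrow> real" where
  "entry M p \<equiv> M $ fst p $ snd p"

abbreviation tensor_entry :: "real^'n^'n^'n^'n \<Rightarrow> 'n \<times> 'n \<Rightarrow> 'n \<times> 'n \<Rightarrow> real" where
  "tensor_entry C p q \<equiv> C $ fst p $ snd p $ fst q $ snd q"

lemma sum_pairs: "(\<Sum>p\<in>UNIV. f p) = (\<Sum>i\<in>UNIV. \<Sum>j\<in>UNIV. f (i, j))"
  by (simp add: sum.cartesian_product case_prod_beta' flip: UNIV_Times_UNIV)

lemma inner_matrix: "M \<bullet> N = (\<Sum>p\<in>UNIV. entry M p * entry N p)" for M N :: "real^'n^'n"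
  by (simp add: inner_vec_def sum_pairs)

lemma tensor_apply_entry: "entry (tensor_apply C M) p = (\<Sum>q\<in>UNIV. tensor_entry C p q * entry M q)"
  by (simp add: tensor_apply_def sum_pairs)

lemma tensor_apply_inner:
  "tensor_apply C M \<bullet> N = (\<Sum>p\<in>UNIV. \<Sum>q\<in>UNIV. tensor_entry C p q * (entry M q * entry N p))"
  unfolding inner_matrix tensor_apply_entry by (simp add: sum_distrib_right mult.assoc)

lemma tensor_apply_add: "tensor_apply C (M + N) = tensor_apply C M + tensor_apply C N"
  by (simp add: tensor_apply_def vec_eq_iff distrib_left sum.distrib)

lemma tensor_apply_scale: "tensor_apply C (c *\<^sub>R M) = c *\<^sub>R tensor_apply C M"
  by (simp add: tensor_apply_def vec_eq_iff sum_distrib_left mult.left_commute)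

lemma inner_transpose: "transpose M \<bullet> transpose N = M \<bullet> N" for M N :: "real^'n^'n"
  unfolding inner_vec_def transpose_def by (simp, rule sum.swap)

text \<open>
  The minor symmetries of \<open>C\<close> make its quadratic form depend only on the symmetric part of a
  matrix, so bounds known on symmetric matrices control the quadratic form on all matrices.
\<close>

lemma symmetric_part_quadratic_form:
  fixes M :: "real^'n^'n"
  assumes C: "stiffness_symmetries C"
  defines "E \<equiv> (1 / 2) *\<^sub>R (M + transpose M)"
  shows "symmetric_matrix E" "tensor_apply C E \<bullet> E = tensor_apply C M \<bullet> M"
proof -
  show "symmetric_matrix E"
    by (simp add: symmetric_matrix_def E_def transpose_def vec_eq_iff add.commute)
  have "(\<Sum>k\<in>UNIV. \<Sum>l\<in>UNIV. C $ i $ j $ k $ l * M $ l $ k) = (\<Sum>k\<in>UNIV. \<Sum>l\<in>UNIV. C $ i $ j $ k $ l * M $ k $ l)" for i j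
  proof -
    have "(\<Sum>k\<in>UNIV. \<Sum>l\<in>UNIV. C $ i $ j $ k $ l * M $ l $ k) = (\<Sum>k\<in>UNIV. \<Sum>l\<in>UNIV. C $ i $ j $ l $ k * M $ l $ k)"
      using C unfolding stiffness_symmetries_def by (intro sum.cong refl) metis
    also have "\<dots> = (\<Sum>k\<in>UNIV. \<Sum>l\<in>UNIV. C $ i $ j $ k $ l * M $ k $ l)"
      by (rule sum.swap)
    finally show ?thesis .
  qed
  then have "tensor_apply C (transpose M) = tensor_apply C M"
    by (simp add: tensor_apply_def transpose_def vec_eq_iff)
  then have CE: "tensor_apply C E = tensor_apply C M"
    by (simp add: E_def tensor_apply_add tensor_apply_scale)
  have sym: "transpose (tensor_apply C M) = tensor_apply C M"
    using C unfolding stiffness_symmetries_def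
    by (simp add: transpose_def tensor_apply_def vec_eq_iff)
  have "tensor_apply C M \<bullet> transpose M = tensor_apply C M \<bullet> M"
    using inner_transpose[of "tensor_apply C M" M] by (simp add: sym)
  then show "tensor_apply C E \<bullet> E = tensor_apply C M \<bullet> M"
    unfolding CE by (simp add: E_def inner_add_right)
qed

text \<open>
  The identity on symmetric matrices as a stiffness tensor.  It puts the two-sided bound on \<open>C\<close>
  into the form of positive semidefiniteness of \<open>C - Clow I\<close> and \<open>Cup I - C\<close>.
\<close>

definition symmetrizer :: "real^'n^'n^'n^'n" where
  "symmetrizer = (\<chi> i j k l. (of_bool (i = k \<and> j = l) + of_bool (i = l \<and> j = k)) / 2)"

lemma stiffness_symmetries_symmetrizer:
  "stiffness_symmetries (symmetrizer :: real^'n^'n^'n^'n)"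
  unfolding stiffness_symmetries_def
proof (intro allI)
  fix i j k l :: 'n
  have "(k = i) = (i = k)" "(l = j) = (j = l)" "(k = j) = (j = k)" "(l = i) = (i = l)"
    by auto
  then show "symmetrizer $ i $ j $ k $ l = symmetrizer $ j $ i $ k $ l
      \<and> symmetrizer $ i $ j $ k $ l = symmetrizer $ i $ j $ l $ k
      \<and> symmetrizer $ i $ j $ k $ l = symmetrizer $ k $ l $ i $ j"
    by (cases "i = k"; cases "j = l"; cases "i = l"; cases "j = k") (simp_all only: symmetrizer_def vec_lambda_beta simp_thms of_bool_eq add.commute)
qed

lemma tensor_apply_symmetrizer:
  "tensor_apply symmetrizer M = (1 / 2) *\<^sub>R (M + transpose M)" for M :: "real^'n^'n"
proof -
  have 1: "(\<Sum>k\<in>UNIV. \<Sum>l\<in>UNIV. of_bool (i = k \<and> j = l) * M $ k $ l) = M $ i $ j" for i j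
  proof -
    have "(\<Sum>k\<in>UNIV. \<Sum>l\<in>UNIV. of_bool (i = k \<and> j = l) * M $ k $ l)
        = (\<Sum>k\<in>UNIV. if k = i then (\<Sum>l\<in>UNIV. if l = j then M $ i $ j else 0) else 0)"
      by (intro sum.cong refl) (auto intro!: sum.cong)
    then show ?thesis by simp
  qed
  have 2: "(\<Sum>k\<in>UNIV. \<Sum>l\<in>UNIV. of_bool (i = l \<and> j = k) * M $ k $ l) = M $ j $ i" for i j
    using 1[of j i] by (simp add: conj_commute)
  have "(\<Sum>k\<in>UNIV. \<Sum>l\<in>UNIV. (of_bool (i = k \<and> j = l) + of_bool (i = l \<and> j = k)) / 2 * M $ k $ l)
      = (M $ i $ j + M $ j $ i) / 2" for i j
  proof -
    have "(\<Sum>k\<in>UNIV. \<Sum>l\<in>UNIV. (of_bool (i = k \<and> j = l) + of_bool (i = l \<and> j = k)) / 2 * M $ k $ l)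
      = (\<Sum>k\<in>UNIV. \<Sum>l\<in>UNIV. (of_bool (i = k \<and> j = l) * M $ k $ l + of_bool (i = l \<and> j = k) * M $ k $ l) / 2)"
      by (simp only: distrib_right times_divide_eq_left)
    also have "\<dots> = (M $ i $ j + M $ j $ i) / 2"
      by (simp only: sum_divide_distrib[symmetric] sum.distrib 1 2)
    finally show ?thesis .
  qed
  then show ?thesis
    by (simp add: tensor_apply_def symmetrizer_def vec_eq_iff transpose_def)
qed

lemma grad_entry:
  assumes "u differentiable (at x)"
  shows "grad u x $ i $ j = frechet_derivative (\<lambda>x. u x $ i) (at x) (axis j 1)"
  unfolding frechet_derivative_bounded_linear[OF bounded_linear_vec_nth assms]
  by (simp add: grad_def jacobian_def matrix_def)

lemma test_functions_differentiable: "u \<in> test_functions \<Omega> \<Longrightarrow> u differentiable (at x)"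
  by (simp add: test_functions_def smooth_imp_differentiable)

lemma test_functions_component:
  "u \<in> test_functions \<Omega> \<Longrightarrow> (\<lambda>x. u x $ i) \<in> test_functions \<Omega>"
  for u :: "'a::euclidean_space \<Rightarrow> real^'n"
  by (rule test_functions_bounded_linear[OF bounded_linear_vec_nth])

lemma test_functions_scale:
  "u \<in> test_functions \<Omega> \<Longrightarrow> (\<lambda>x. c *\<^sub>R u x) \<in> test_functions \<Omega>"
  by (rule test_functions_bounded_linear[OF bounded_linear_scaleR_right])

lemma test_functions_grad:
  assumes u: "u \<in> test_functions \<Omega>"
  shows "(\<lambda>x. entry (grad u x) p) \<in> test_functions \<Omega>"
  unfolding grad_entry[OF test_functions_differentiable[OF u]]
  by (intro test_functions_directional_derivative test_functions_component u)

lemma strain_entry: "entry (strain u x) p = (1 / 2) * (entry (grad u x) p + entry (grad u x) (prod.swap p))"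
  by (simp add: strain_def transpose_def)

lemma test_functions_strain:
  assumes u: "u \<in> test_functions \<Omega>"
  shows "(\<lambda>x. entry (strain u x) p) \<in> test_functions \<Omega>"
  unfolding strain_entry
  using test_functions_scale[OF test_functions_add[OF test_functions_grad[OF u] test_functions_grad[OF u]], of "1 / 2" p "prod.swap p"]
  by simp

lemma grad_add:
  assumes "u differentiable (at x)" "v differentiable (at x)"
  shows "grad (\<lambda>x. u x + v x) x = grad u x + grad v x"
proof -
  have "((\<lambda>x. u x + v x) has_derivative (\<lambda>h. frechet_derivative u (at x) h + frechet_derivative v (at x) h)) (at x)"
    using assms by (intro has_derivative_add) (simp_all add: frechet_derivative_works)
  then have "frechet_derivative (\<lambda>x. u x + v x) (at x)
      = (\<lambda>h. frechet_derivative u (at x) h + frechet_derivative v (at x) h)"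
    by (rule frechet_derivative_at[symmetric])
  then show ?thesis
    by (simp add: grad_def jacobian_def matrix_def vec_eq_iff)
qed

lemma grad_scale:
  assumes "u differentiable (at x)"
  shows "grad (\<lambda>x. c *\<^sub>R u x) x = c *\<^sub>R grad u x"
  using frechet_derivative_bounded_linear[OF bounded_linear_scaleR_right assms]
  by (simp add: grad_def jacobian_def matrix_def vec_eq_iff)

lemma strain_add:
  assumes "u differentiable (at x)" "v differentiable (at x)"
  shows "strain (\<lambda>x. u x + v x) x = strain u x + strain v x"
  unfolding strain_def grad_add[OF assms] by (simp add: transpose_def vec_eq_iff algebra_simps)

lemma strain_scale:
  assumes "u differentiable (at x)"
  shows "strain (\<lambda>x. c *\<^sub>R u x) x = c *\<^sub>R strain u x"
  unfolding strain_def grad_scale[OF assms] by (simp add: transpose_def vec_eq_iff algebra_simps)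

section \<open>The elastic form of a positive definite kernel\<close>

locale positive_kernel = integrable_kernel \<Omega> A
  for \<Omega> :: "(real^'n) set" and A :: "real^'n \<Rightarrow> real^'n \<Rightarrow> real" +
  assumes open_domain: "open \<Omega>"
    and symmetric: "A x x' = A x' x"
    and translation_invariant: "A (x + a) (x' + a) = A x x'"
    and positive: "strictly_pos_def_kernel \<Omega> A"
begin

abbreviation T :: "(real^'n \<Rightarrow> real) \<Rightarrow> (real^'n \<Rightarrow> real) \<Rightarrow> real" where
  "T \<equiv> kernel_form \<Omega> A"

sublocale T: semi_inner_form "test_functions \<Omega> :: (real^'n \<Rightarrow> real) set" T
proof
  fix u v w :: "real^'n \<Rightarrow> real" and c :: real
  assume u: "u \<in> test_functions \<Omega>" and w: "w \<in> test_functions \<Omega>"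
  show "(\<lambda>x. c *\<^sub>R u x) \<in> test_functions \<Omega>"
    using u by (rule test_functions_scale)
  show "T (\<lambda>x. c *\<^sub>R u x) w = c * T u w"
    by (simp add: kernel_form_scale_left)
  show "T u w = T w u"
    using u w by (intro kernel_form_commute symmetric test_functions_imp_bounded_continuous)
  show "0 \<le> T u u"
  proof (cases "u = (\<lambda>x. 0)")
    case True
    then show ?thesis using kernel_form_scale_left[of 0 u u] by simp
  next
    case False
    then show ?thesis
      using positive u unfolding strictly_pos_def_kernel_def kernel_form_def by (auto intro: less_imp_le)
  qed
  assume v: "v \<in> test_functions \<Omega>"
  show "(\<lambda>x. u x + v x) \<in> test_functions \<Omega>"
    using u v by (rule test_functions_add)
  show "T (\<lambda>x. u x + v x) w = T u w + T v w"
    using u v w by (intro kernel_form_add_left test_functions_imp_bounded_continuous)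
qed

lemma inner_A_eq:
  assumes u: "u \<in> test_functions \<Omega>" and v: "v \<in> test_functions \<Omega>"
  shows "inner_A \<Omega> A u v = (\<Sum>p\<in>UNIV. T (\<lambda>x. entry (grad u x) p) (\<lambda>x. entry (grad v x) p))"
proof -
  note bc = test_functions_imp_bounded_continuous[OF test_functions_grad]
  show ?thesis
    unfolding inner_A_def inner_matrix
    using iterated_integral_sum[where P = UNIV and c = "\<lambda>_. 1" and f = "\<lambda>p x. entry (grad u x) p"
        and g = "\<lambda>p x. entry (grad v x) p", OF bc[OF u] bc[OF v]]
    by simp
qed

lemma form_a_eq:
  assumes u: "u \<in> test_functions \<Omega>" and v: "v \<in> test_functions \<Omega>"
  shows "form_a \<Omega> A C u v
    = (\<Sum>p\<in>UNIV. \<Sum>q\<in>UNIV. tensor_entry C p q * T (\<lambda>x. entry (strain u x) q) (\<lambda>x. entry (strain v x) p))"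
proof -
  note bc = test_functions_imp_bounded_continuous[OF test_functions_strain]
  have pairs: "(\<Sum>r\<in>UNIV. F r) = (\<Sum>p\<in>UNIV. \<Sum>q\<in>UNIV. F (p, q))" for F :: "('n \<times> 'n) \<times> ('n \<times> 'n) \<Rightarrow> real"
    by (rule sum_pairs)
  show ?thesis
    unfolding form_a_def tensor_apply_inner
    using iterated_integral_sum[where P = UNIV and c = "\<lambda>r. tensor_entry C (fst r) (snd r)"
        and f = "\<lambda>r x. entry (strain u x) (snd r)" and g = "\<lambda>r x. entry (strain v x) (fst r)",
        OF bc[OF u] bc[OF v]]
    unfolding pairs fst_conv snd_conv .
qed

lemma form_a_symmetrizer:
  assumes u: "u \<in> test_functions \<Omega>" and v: "v \<in> test_functions \<Omega>"
  shows "form_a \<Omega> A symmetrizer u v = (\<Sum>p\<in>UNIV. T (\<lambda>x. entry (strain u x) p) (\<lambda>x. entry (strain v x) p))"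
proof -
  note bc = test_functions_imp_bounded_continuous[OF test_functions_strain]
  have "transpose (strain u x) = strain u x" for x
    by (simp add: strain_def transpose_def vec_eq_iff add.commute)
  then have "tensor_apply symmetrizer (strain u x) = strain u x" for x
    by (simp add: tensor_apply_symmetrizer)
  then show ?thesis
    unfolding form_a_def
    using iterated_integral_sum[where P = UNIV and c = "\<lambda>_. 1" and f = "\<lambda>p x. entry (strain u x) p"
        and g = "\<lambda>p x. entry (strain v x) p", OF bc[OF u] bc[OF v]]
    by (simp add: inner_matrix)
qed

lemma form_a_linear_combination:
  assumes "u \<in> test_functions \<Omega>" "v \<in> test_functions \<Omega>"
  shows "form_a \<Omega> A (a *\<^sub>R C + b *\<^sub>R D) u v = a * form_a \<Omega> A C u v + b * form_a \<Omega> A D u v"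
  unfolding form_a_eq[OF assms]
  by (simp add: distrib_right sum.distrib sum_distrib_left mult.assoc)

lemma form_a_commute:
  assumes C: "stiffness_symmetries C" and u: "u \<in> test_functions \<Omega>" and v: "v \<in> test_functions \<Omega>"
  shows "form_a \<Omega> A C u v = form_a \<Omega> A C v u"
proof -
  have "tensor_entry C p q = tensor_entry C q p" for p q
    using C by (auto simp: stiffness_symmetries_def)
  then show ?thesis
    unfolding form_a_eq[OF u v] form_a_eq[OF v u]
    by (subst sum.swap) (intro sum.cong refl arg_cong2[where f = times] T.commute test_functions_strain u v)
qed

lemma form_a_add_left:
  assumes u: "u \<in> test_functions \<Omega>" and v: "v \<in> test_functions \<Omega>" and w: "w \<in> test_functions \<Omega>"
  shows "form_a \<Omega> A C (\<lambda>x. u x + v x) w = form_a \<Omega> A C u w + form_a \<Omega> A C v w"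
  unfolding form_a_eq[OF u w] form_a_eq[OF v w] form_a_eq[OF test_functions_add[OF u v] w]
  by (simp add: strain_add[OF test_functions_differentiable[OF u] test_functions_differentiable[OF v]]
      T.add_left test_functions_strain u v w distrib_left sum.distrib)

lemma form_a_scale_left:
  assumes u: "u \<in> test_functions \<Omega>" and w: "w \<in> test_functions \<Omega>"
  shows "form_a \<Omega> A C (\<lambda>x. c *\<^sub>R u x) w = c * form_a \<Omega> A C u w"
  unfolding form_a_eq[OF u w] form_a_eq[OF test_functions_scale[OF u] w]
  by (simp add: strain_scale[OF test_functions_differentiable[OF u]]
      kernel_form_scale_left sum_distrib_left mult.left_commute)

text \<open>
  The form pairs two positive semidefinite matrices indexed by pairs of coordinates: the tensor
  \<open>D\<close>, and the Gram matrix of the entries of the strain with respect to the kernel.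
\<close>

lemma form_a_nonneg:
  assumes D: "stiffness_symmetries D"
    and psd: "\<And>M. symmetric_matrix M \<Longrightarrow> 0 \<le> tensor_apply D M \<bullet> M"
    and u: "u \<in> test_functions \<Omega>"
  shows "0 \<le> form_a \<Omega> A D u u"
  unfolding form_a_eq[OF u u]
proof (rule Schur_product_sum_nonneg)
  show "tensor_entry D p q = tensor_entry D q p" for p q
    using D by (auto simp: stiffness_symmetries_def)
  show "0 \<le> (\<Sum>p\<in>UNIV. \<Sum>q\<in>UNIV. tensor_entry D p q * x p * x q)" for x
  proof -
    let ?M = "\<chi> i j. x (i, j)"
    note part = symmetric_part_quadratic_form[where M = ?M, OF D]
    have "0 \<le> tensor_apply D ?M \<bullet> ?M"
      using psd[OF part(1)] unfolding part(2) .
    then show ?thesis by (simp add: tensor_apply_inner mult_ac)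
  qed
  show "0 \<le> (\<Sum>p\<in>UNIV. \<Sum>q\<in>UNIV. T (\<lambda>x. entry (strain u x) q) (\<lambda>x. entry (strain u x) p) * x p * x q)" for x
    using T.Gram_nonneg[where c = x, OF finite test_functions_strain[OF u]]
    by (simp add: T.commute[OF test_functions_strain[OF u] test_functions_strain[OF u]])
qed simp

text \<open>
  With \<open>g i j\<close> the partial derivative of component \<open>i\<close> in direction \<open>j\<close>, expanding the strain gives
  half of the squared norm of \<open>u\<close> plus half of \<open>X = (\<Sum>i j. T (g i j) (g j i))\<close>.  Exchanging the two
  derivatives turns \<open>X\<close> into \<open>(\<Sum>i j. T (g i i) (g j j))\<close>, the kernel form at the divergence of \<open>u\<close>,
  which is nonnegative.  The upper bound is the nonnegativity of \<open>T\<close> at the differences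
  \<open>g i j - g j i\<close>.
\<close>

lemma Korn:
  assumes u: "u \<in> test_functions \<Omega>"
  shows "1 / 2 * inner_A \<Omega> A u u \<le> form_a \<Omega> A symmetrizer u u"
    and "form_a \<Omega> A symmetrizer u u \<le> inner_A \<Omega> A u u"
proof -
  let ?g = "\<lambda>p x. entry (grad u x) p"
  let ?X = "\<Sum>p\<in>UNIV. T (?g p) (?g (prod.swap p))"
  note g = test_functions_grad[OF u]
  have swap: "(\<Sum>p\<in>UNIV. f (prod.swap p)) = (\<Sum>p\<in>UNIV. f p)" for f :: "'n \<times> 'n \<Rightarrow> real"
    unfolding sum_pairs by (simp, rule sum.swap)
  have square: "T (?g p) (?g p) + T (?g (prod.swap p)) (?g (prod.swap p)) + 2 * T (?g p) (?g (prod.swap p))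
      = T (\<lambda>x. ?g p x + ?g (prod.swap p) x) (\<lambda>x. ?g p x + ?g (prod.swap p) x)" for p
    by (simp only: T.add_left T.add_right T.add_closed g T.commute[OF g g, of "prod.swap p" p])
  have strain: "form_a \<Omega> A symmetrizer u u = 1 / 2 * inner_A \<Omega> A u u + 1 / 2 * ?X"
  proof -
    have "T (\<lambda>x. entry (strain u x) p) (\<lambda>x. entry (strain u x) p)
      = 1 / 4 * (T (?g p) (?g p) + T (?g (prod.swap p)) (?g (prod.swap p)) + 2 * T (?g p) (?g (prod.swap p)))" for p
      unfolding strain_entry kernel_form_scale square by simp
    then have "form_a \<Omega> A symmetrizer u u
      = 1 / 4 * (inner_A \<Omega> A u u + (\<Sum>p\<in>UNIV. T (?g (prod.swap p)) (?g (prod.swap p))) + 2 * ?X)"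
      unfolding form_a_symmetrizer[OF u u] inner_A_eq[OF u u]
      by (simp only: sum.distrib flip: sum_distrib_left)
    also have "(\<Sum>p\<in>UNIV. T (?g (prod.swap p)) (?g (prod.swap p))) = inner_A \<Omega> A u u"
      unfolding inner_A_eq[OF u u] by (rule swap)
    finally show ?thesis by simp
  qed
  have "0 \<le> ?X"
  proof -
    have "T (?g (i, j)) (?g (j, i)) = T (?g (i, i)) (?g (j, j))" for i j
      unfolding fst_conv snd_conv grad_entry[OF test_functions_differentiable[OF u]]
      by (intro kernel_form_swap_derivatives open_domain translation_invariant test_functions_component u)
    then have "?X = (\<Sum>i\<in>UNIV. \<Sum>j\<in>UNIV. T (?g (i, i)) (?g (j, j)))"
      unfolding sum_pairs by simp
    also have "\<dots> \<ge> 0"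
      using T.Gram_nonneg[where I = UNIV and u = "\<lambda>i. ?g (i, i)" and c = "\<lambda>_. 1", OF finite g] by simp
    finally show ?thesis .
  qed
  then show "1 / 2 * inner_A \<Omega> A u u \<le> form_a \<Omega> A symmetrizer u u"
    unfolding strain by simp
  have "2 * T (?g p) (?g (prod.swap p)) \<le> T (?g p) (?g p) + T (?g (prod.swap p)) (?g (prod.swap p))" for p
  proof -
    note bc = test_functions_imp_bounded_continuous[OF g]
    have "0 \<le> T (\<lambda>x. ?g p x - ?g (prod.swap p) x) (\<lambda>x. ?g p x - ?g (prod.swap p) x)"
      by (intro T.nonneg T.diff_closed g)
    then show ?thesis
      unfolding kernel_form_diff[OF bc bc bc bc]
      using T.commute[OF g g, of "prod.swap p" p] by linarith
  qed
  then have "(\<Sum>p\<in>UNIV. 2 * T (?g p) (?g (prod.swap p)))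
      \<le> (\<Sum>p\<in>UNIV. T (?g p) (?g p) + T (?g (prod.swap p)) (?g (prod.swap p)))"
    by (rule sum_mono)
  then have "2 * ?X \<le> inner_A \<Omega> A u u + (\<Sum>p\<in>UNIV. T (?g (prod.swap p)) (?g (prod.swap p)))"
    unfolding inner_A_eq[OF u u] by (simp only: sum.distrib sum_distrib_left)
  also have "(\<Sum>p\<in>UNIV. T (?g (prod.swap p)) (?g (prod.swap p))) = inner_A \<Omega> A u u"
    unfolding inner_A_eq[OF u u] by (rule swap)
  finally show "form_a \<Omega> A symmetrizer u u \<le> inner_A \<Omega> A u u"
    unfolding strain by simp
qed

lemma form_a_bounds:
  assumes C: "stiffness_symmetries C"
    and bounds: "\<And>M. symmetric_matrix M \<Longrightarrow>
      Clow * (M \<bullet> M) \<le> tensor_apply C M \<bullet> M \<and> tensor_apply C M \<bullet> M \<le> Cup * (M \<bullet> M)"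
    and nonneg: "0 \<le> Clow" "0 \<le> Cup"
    and u: "u \<in> test_functions \<Omega>"
  shows "1 / 2 * Clow * inner_A \<Omega> A u u \<le> form_a \<Omega> A C u u"
    and "form_a \<Omega> A C u u \<le> Cup * inner_A \<Omega> A u u"
proof -
  have sym: "stiffness_symmetries (a *\<^sub>R C + b *\<^sub>R symmetrizer)" for a b
    unfolding stiffness_symmetries_def
  proof (intro allI)
    fix i j k l
    have "C $ i $ j $ k $ l = C $ j $ i $ k $ l \<and> C $ i $ j $ k $ l = C $ i $ j $ l $ k \<and> C $ i $ j $ k $ l = C $ k $ l $ i $ j"
      using C unfolding stiffness_symmetries_def by blast
    moreover have "symmetrizer $ i $ j $ k $ l = symmetrizer $ j $ i $ k $ l
        \<and> symmetrizer $ i $ j $ k $ l = symmetrizer $ i $ j $ l $ k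
        \<and> symmetrizer $ i $ j $ k $ l = symmetrizer $ k $ l $ i $ j"
      using stiffness_symmetries_symmetrizer unfolding stiffness_symmetries_def by blast
    ultimately show "(a *\<^sub>R C + b *\<^sub>R symmetrizer) $ i $ j $ k $ l = (a *\<^sub>R C + b *\<^sub>R symmetrizer) $ j $ i $ k $ l
        \<and> (a *\<^sub>R C + b *\<^sub>R symmetrizer) $ i $ j $ k $ l = (a *\<^sub>R C + b *\<^sub>R symmetrizer) $ i $ j $ l $ k
        \<and> (a *\<^sub>R C + b *\<^sub>R symmetrizer) $ i $ j $ k $ l = (a *\<^sub>R C + b *\<^sub>R symmetrizer) $ k $ l $ i $ j"
      unfolding vector_add_component vector_scaleR_component by metis
  qed
  have quad: "tensor_apply (a *\<^sub>R C + b *\<^sub>R symmetrizer) M \<bullet> M = a * (tensor_apply C M \<bullet> M) + b * (M \<bullet> M)"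
    if "symmetric_matrix M" for a b and M :: "real^'n^'n"
  proof -
    have "tensor_apply symmetrizer M = M"
      using that by (simp add: tensor_apply_symmetrizer symmetric_matrix_def vec_eq_iff)
    then have "M \<bullet> M = tensor_apply symmetrizer M \<bullet> M" by simp
    then show ?thesis
      by (simp add: tensor_apply_inner distrib_right sum.distrib sum_distrib_left mult.assoc)
  qed
  have "0 \<le> form_a \<Omega> A (1 *\<^sub>R C + (- Clow) *\<^sub>R symmetrizer) u u"
  proof (rule form_a_nonneg[OF sym _ u])
    show "0 \<le> tensor_apply (1 *\<^sub>R C + (- Clow) *\<^sub>R symmetrizer) M \<bullet> M" if "symmetric_matrix M" for M
      unfolding quad[OF that] using bounds[OF that] by simp
  qed
  then have "Clow * form_a \<Omega> A symmetrizer u u \<le> form_a \<Omega> A C u u"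
    unfolding form_a_linear_combination[OF u u] by simp
  then show "1 / 2 * Clow * inner_A \<Omega> A u u \<le> form_a \<Omega> A C u u"
    using mult_left_mono[OF Korn(1)[OF u] nonneg(1)] by simp
  have "0 \<le> form_a \<Omega> A ((- 1) *\<^sub>R C + Cup *\<^sub>R symmetrizer) u u"
  proof (rule form_a_nonneg[OF sym _ u])
    show "0 \<le> tensor_apply ((- 1) *\<^sub>R C + Cup *\<^sub>R symmetrizer) M \<bullet> M" if "symmetric_matrix M" for M
      unfolding quad[OF that] using bounds[OF that] by simp
  qed
  then have "form_a \<Omega> A C u u \<le> Cup * form_a \<Omega> A symmetrizer u u"
    unfolding form_a_linear_combination[OF u u] by simp
  then show "form_a \<Omega> A C u u \<le> Cup * inner_A \<Omega> A u u"
    using mult_left_mono[OF Korn(2)[OF u] nonneg(2)] by simp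
qed

sublocale inner_A: semi_inner_form "test_functions \<Omega> :: (real^'n \<Rightarrow> real^'n) set" "inner_A \<Omega> A"
proof
  fix u v w :: "real^'n \<Rightarrow> real^'n" and c :: real
  assume u: "u \<in> test_functions \<Omega>" and w: "w \<in> test_functions \<Omega>"
  show "(\<lambda>x. c *\<^sub>R u x) \<in> test_functions \<Omega>"
    using u by (rule test_functions_scale)
  show "inner_A \<Omega> A (\<lambda>x. c *\<^sub>R u x) w = c * inner_A \<Omega> A u w"
    unfolding inner_A_eq[OF u w] inner_A_eq[OF test_functions_scale[OF u] w]
    by (simp add: grad_scale[OF test_functions_differentiable[OF u]] kernel_form_scale_left sum_distrib_left)
  show "inner_A \<Omega> A u w = inner_A \<Omega> A w u"
    unfolding inner_A_eq[OF u w] inner_A_eq[OF w u]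
    by (intro sum.cong refl T.commute test_functions_grad u w)
  show "0 \<le> inner_A \<Omega> A u u"
    unfolding inner_A_eq[OF u u] by (intro sum_nonneg T.nonneg test_functions_grad u)
  assume v: "v \<in> test_functions \<Omega>"
  show "(\<lambda>x. u x + v x) \<in> test_functions \<Omega>"
    using u v by (rule test_functions_add)
  show "inner_A \<Omega> A (\<lambda>x. u x + v x) w = inner_A \<Omega> A u w + inner_A \<Omega> A v w"
    unfolding inner_A_eq[OF u w] inner_A_eq[OF v w] inner_A_eq[OF test_functions_add[OF u v] w]
    by (simp add: grad_add[OF test_functions_differentiable[OF u] test_functions_differentiable[OF v]]
        T.add_left test_functions_grad u v w sum.distrib)
qed

end

section \<open>Boundedness and coercivity on the completion\<close>

theorem theorem10:
  fixes \<Omega> :: "(real^'n) set"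
    and At :: "real \<Rightarrow> real"
    and A :: "real^'n \<Rightarrow> real^'n \<Rightarrow> real"
    and C :: "real^'n^'n^'n^'n"
    and Clow Cup :: real
  assumes "CARD('n) \<in> {1, 2, 3}"
    and "bounded \<Omega>" and "open \<Omega>" and "connected \<Omega>" and "lipschitz_boundary \<Omega>"
    and "\<And>r. At (- r) = At r"
    and "A = radial_kernel At"
    and "set_integrable lebesgue (\<Omega> \<times> \<Omega>) (\<lambda>(x, x'). A x x')"
    and "strictly_pos_def_kernel \<Omega> A"
    and "stiffness_symmetries C"
    and "0 < Clow" and "Clow \<le> Cup"
    and "\<And>M. symmetric_matrix M \<Longrightarrow>
           Clow * (M \<bullet> M) \<le> tensor_apply C M \<bullet> M \<and> tensor_apply C M \<bullet> M \<le> Cup * (M \<bullet> M)"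
  shows
    "(\<forall>u\<in>test_functions \<Omega>. \<forall>v\<in>test_functions \<Omega>.
        \<bar>form_a \<Omega> A C u v\<bar> \<le> Cup * form_norm (inner_A \<Omega> A) u * form_norm (inner_A \<Omega> A) v \<and>
        form_a \<Omega> A C u u \<ge> 1 / 2 * Clow * inner_A \<Omega> A u u) \<and>
     extends_continuously (test_functions \<Omega>) (inner_A \<Omega> A) (inner_A \<Omega> A) \<and>
     extends_continuously (test_functions \<Omega>) (inner_A \<Omega> A) (form_a \<Omega> A C) \<and>
     bilinear_on_completion (test_functions \<Omega>) (inner_A \<Omega> A) (form_ext (form_a \<Omega> A C)) \<and>
     (\<forall>U\<in>V_A \<Omega> A. \<forall>W\<in>V_A \<Omega> A.
        \<bar>form_ext (form_a \<Omega> A C) U W\<bar>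
          \<le> Cup * form_norm (form_ext (inner_A \<Omega> A)) U * form_norm (form_ext (inner_A \<Omega> A)) W \<and>
        form_ext (form_a \<Omega> A C) U U \<ge> 1 / 2 * Clow * form_ext (inner_A \<Omega> A) U U)"
proof -
  let ?S = "test_functions \<Omega> :: (real^'n \<Rightarrow> real^'n) set"
  let ?p = "inner_A \<Omega> A" and ?a = "form_a \<Omega> A C"
  interpret positive_kernel \<Omega> A
  proof
    show "set_integrable lebesgue (\<Omega> \<times> \<Omega>) (\<lambda>(x, x'). A x x')" by fact
    show "open \<Omega>" "strictly_pos_def_kernel \<Omega> A" by fact+
    show "A x x' = A x' x" "A (x + a) (x' + a) = A x x'" for x x' a
      using \<open>A = radial_kernel At\<close> by (simp_all add: radial_kernel_def norm_minus_commute)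
  qed
  note C = \<open>stiffness_symmetries C\<close>
  have nonneg: "0 \<le> Clow" "0 \<le> Cup" using \<open>0 < Clow\<close> \<open>Clow \<le> Cup\<close> by simp_all
  have lower: "1 / 2 * Clow * ?p u u \<le> ?a u u" and upper: "?a u u \<le> Cup * ?p u u" if "u \<in> ?S" for u
    using form_a_bounds[OF C assms(13) nonneg that] by simp_all
  \<comment> \<open>Coercivity makes the elastic form itself a semi-inner product, so it satisfies a
    Cauchy-Schwarz inequality of its own, and the quadratic bound with constant \<open>Cup\<close> carries over
    to different arguments with the same constant.\<close>
  interpret a: semi_inner_form ?S ?a
  proof
    show "0 \<le> ?a u u" if "u \<in> ?S" for u
      using mult_nonneg_nonneg[OF nonneg(1) inner_A.nonneg[OF that]] lower[OF that] by linarith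
  qed (intro inner_A.add_closed inner_A.scale_closed form_a_add_left form_a_scale_left form_a_commute C, assumption+)+
  have a_norm: "form_norm ?a u \<le> sqrt Cup * form_norm ?p u" if "u \<in> ?S" for u
    using upper[OF that] by (simp add: form_norm_def flip: real_sqrt_mult)
  have bound: "\<bar>?a u v\<bar> \<le> Cup * form_norm ?p u * form_norm ?p v" if "u \<in> ?S" "v \<in> ?S" for u v
  proof -
    have "\<bar>?a u v\<bar> \<le> form_norm ?a u * form_norm ?a v"
      by (rule a.Cauchy_Schwarz[OF that])
    also have "\<dots> \<le> (sqrt Cup * form_norm ?p u) * (sqrt Cup * form_norm ?p v)"
      using that nonneg by (intro mult_mono a_norm mult_nonneg_nonneg a.form_norm_nonneg inner_A.form_norm_nonneg) simp_all
    also have "\<dots> = (sqrt Cup * sqrt Cup) * form_norm ?p u * form_norm ?p v"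
      by (simp only: mult_ac)
    also have "sqrt Cup * sqrt Cup = Cup" using nonneg(2) by simp
    finally show ?thesis .
  qed
  interpret pb: bounded_form ?S ?p ?p 1
    by unfold_locales
      (use inner_A.Cauchy_Schwarz in \<open>simp_all add: inner_A.add_left inner_A.add_right inner_A.scale_left inner_A.scale_right\<close>)
  interpret ab: bounded_form ?S ?p ?a Cup
    by unfold_locales
      (simp_all add: a.add_left a.add_right a.scale_left a.scale_right bound)
  have "\<bar>form_ext ?a U W\<bar> \<le> Cup * form_norm (form_ext ?p) U * form_norm (form_ext ?p) W \<and>
      form_ext ?a U U \<ge> 1 / 2 * Clow * form_ext ?p U U"
    if U: "U \<in> V_A \<Omega> A" and W: "W \<in> V_A \<Omega> A" for U W
  proof -
    have UW: "U \<in> hilbert_completion ?S ?p" "W \<in> hilbert_completion ?S ?p"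
      using U W by (simp_all add: V_A_def)
    obtain u where u: "u \<in> U" "u \<in> cauchy_seqs ?S ?p"
      using UW(1) by (rule inner_A.completion_obtain)
    obtain w where w: "w \<in> W" "w \<in> cauchy_seqs ?S ?p"
      using UW(2) by (rule inner_A.completion_obtain)
    note mem = inner_A.cauchy_seqsD[OF u(2)] inner_A.cauchy_seqsD[OF w(2)]
    note lim_a = ab.form_ext_tendsto and lim_p = pb.form_ext_tendsto
    have "\<bar>form_ext ?a U W\<bar> \<le> Cup * form_norm (form_ext ?p) U * form_norm (form_ext ?p) W"
    proof (rule LIMSEQ_le)
      show "(\<lambda>k. \<bar>?a (u k) (w k)\<bar>) \<longlonglongrightarrow> \<bar>form_ext ?a U W\<bar>"
        by (intro tendsto_rabs lim_a UW u w)
      show "(\<lambda>k. Cup * form_norm ?p (u k) * form_norm ?p (w k))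
          \<longlonglongrightarrow> Cup * form_norm (form_ext ?p) U * form_norm (form_ext ?p) W"
        unfolding form_norm_def by (intro tendsto_mult tendsto_const tendsto_real_sqrt lim_p UW u w)
      show "\<exists>N. \<forall>k\<ge>N. \<bar>?a (u k) (w k)\<bar> \<le> Cup * form_norm ?p (u k) * form_norm ?p (w k)"
        using bound mem by blast
    qed
    moreover have "1 / 2 * Clow * form_ext ?p U U \<le> form_ext ?a U U"
    proof (rule LIMSEQ_le)
      show "(\<lambda>k. 1 / 2 * Clow * ?p (u k) (u k)) \<longlonglongrightarrow> 1 / 2 * Clow * form_ext ?p U U"
        by (intro tendsto_mult_left lim_p UW u)
      show "(\<lambda>k. ?a (u k) (u k)) \<longlonglongrightarrow> form_ext ?a U U"
        by (intro lim_a UW u)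
      show "\<exists>N. \<forall>k\<ge>N. 1 / 2 * Clow * ?p (u k) (u k) \<le> ?a (u k) (u k)"
        using lower mem by blast
    qed
    ultimately show ?thesis by simp
  qed
  then show ?thesis
    using bound lower pb.extends_continuously ab.extends_continuously ab.bilinear_on_completion by blast
qed

end
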